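(* Let $(\mathsf{H},\Sigma,\mathbb{R}^d)$ be a cut and project scheme with a window $W$, and let $\Xi^\Gamma$ be the associated internal system. There exists an onto and proper continuous semigroup morphism $$\Pi^*:E(\Xi^\Gamma,\Gamma)\longrightarrow\mathsf{H}$$ that satisfies the equivariance relation $\Pi(\Lambda.g)=\Pi(\Lambda)+\Pi^*(g)$ for any model set $\Lambda\in\Xi^\Gamma$ and any mapping $g\in E(\Xi^\Gamma,\Gamma)$.
   Context: **Cut and project scheme.** $(\mathsf{H},\Sigma,\mathbb{R}^d)$: $\mathsf{H}$ is a locally compact Abelian group, $\Sigma$ is a countable discrete cocompact subgroup of $\mathsf{H}\times\mathbb{R}^d$, the projection to $\mathbb{R}^d$ is injective on $\Sigma$ with image $\Gamma$, and the projection of $\Sigma$ to $\mathsf{H}$ is a dense subgroup $\Gamma^*$. For $\gamma\in\Gamma$, $\gamma^*\in\mathsf{H}$ is the unique element with $(\gamma^*,\gamma)\in\Sigma$. A window is a compact topologically regular (equal to the closure of its interior) subset $W\subset\mathsf{H}$ which is irredundant: $W+w=W$ only for $w=0$. For $A\subset\mathsf{H}$, $\mathfrak{P}(A)=\{\gamma\in\Gamma:\gamma^*\in A\}$. **Hull.** $NS=(\Gamma^*-\partial W)^c\subset\mathsf{H}$. For $w\in NS$, $t\in\mathbb{R}^d$, the sets $\mathfrak{P}(w+W)-t=\mathfrak{P}(w+\mathring{W})-t$ are the nonsingular model sets; they all have the same language $\mathcal{L}_{NS}$, where $\mathcal{L}_\Lambda=\{(\Lambda-x)\cap B(0,R):x\in\Lambda,R>0\}$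 for $\Lambda\subset\mathbb{R}^d$. The hull is $\mathbb{X}=\{\Lambda\subset\mathbb{R}^d:\mathcal{L}_\Lambda=\mathcal{L}_{NS}\}$. **Internal system.** $\Xi^\Gamma=\{\Lambda\in\mathbb{X}:\Lambda\subset\Gamma\}$ with neighborhood bases $\{\Lambda'\in\Xi^\Gamma:\Lambda\cap K=\Lambda'\cap K\}$, $K\subset\mathbb{R}^d$ compact (a locally compact space); $\Gamma$ acts by homeomorphisms by $\Lambda.\gamma=\Lambda+\gamma$. There is a continuous onto $\Gamma$-equivariant map $\Pi:\Xi^\Gamma\to\mathsf{H}$ (with $\gamma$ acting on $\mathsf{H}$ by translation by $\gamma^*$) sending $\Lambda$ to the unique $w_\Lambda\in\mathsf{H}$ with $\mathfrak{P}(w_\Lambda+\mathring W)\subseteq\Lambda\subseteq\mathfrak{P}(w_\Lambda+W)$. **Ellis semigroup.** $E(\Xi^\Gamma,\Gamma)$ is the closure of (the image of) $\Gamma$ in $(\Xi^\Gamma)^{\Xi^\Gamma}$ for pointwise convergence, with that topology and the product $x.(g.h)=(x.g).h$. *)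

theory Defs
  imports "HOL-Analysis.Analysis"
begin

section \<open>Cut and project schemes\<close>

text \<open>
  The internal group \<open>H\<close> is the type \<open>'h\<close>, of sort
  \<open>{topological_ab_group_add, t2_space}\<close>; local compactness is part of
  \<open>cut_and_project_scheme\<close>. Locally compact groups are Hausdorff by convention, and no
  countability or metrizability of \<open>H\<close> is assumed.
\<close>

definition add_subgroup :: "'a::group_add set \<Rightarrow> bool" where
  "add_subgroup S \<longleftrightarrow> 0 \<in> S \<and> (\<forall>x\<in>S. \<forall>y\<in>S. x + y \<in> S) \<and> (\<forall>x\<in>S. - x \<in> S)"

definition coset_topology :: "'a::{ab_group_add, topological_space} set \<Rightarrow> 'a set topology" where
  "coset_topology S =
     topology (\<lambda>U. U \<subseteq> range (\<lambda>x. (+) x ` S) \<and> open {x. (+) x ` S \<in> U})"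

definition cocompact :: "'a::{ab_group_add, topological_space} set \<Rightarrow> bool" where
  "cocompact S \<longleftrightarrow> compact_space (coset_topology S)"

definition cut_and_project_scheme ::
    "('h::{topological_ab_group_add, t2_space} \<times> (real ^ 'd)) set \<Rightarrow> bool" where
  "cut_and_project_scheme \<Sigma> \<longleftrightarrow>
     locally_compact_space (euclidean :: 'h topology) \<and>
     add_subgroup \<Sigma> \<and> countable \<Sigma> \<and> discrete \<Sigma> \<and> cocompact \<Sigma> \<and>
     inj_on snd \<Sigma> \<and> closure (fst ` \<Sigma>) = UNIV"

definition Gam :: "('h \<times> (real ^ 'd)) set \<Rightarrow> (real ^ 'd) set" where
  "Gam \<Sigma> = snd ` \<Sigma>"

definition star :: "('h \<times> (real ^ 'd)) set \<Rightarrow> real ^ 'd \<Rightarrow> 'h" where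
  "star \<Sigma> \<gamma> = (THE h. (h, \<gamma>) \<in> \<Sigma>)"

definition window :: "'h::{topological_ab_group_add, t2_space} set \<Rightarrow> bool" where
  "window W \<longleftrightarrow> compact W \<and> closure (interior W) = W \<and> (\<forall>w. (+) w ` W = W \<longrightarrow> w = 0)"

definition proj_set :: "('h \<times> (real ^ 'd)) set \<Rightarrow> 'h set \<Rightarrow> (real ^ 'd) set" where
  "proj_set \<Sigma> A = {\<gamma> \<in> Gam \<Sigma>. star \<Sigma> \<gamma> \<in> A}"

section \<open>The hull\<close>

definition NS :: "('h::{topological_ab_group_add, t2_space} \<times> (real ^ 'd)) set \<Rightarrow> 'h set \<Rightarrow> 'h set" where
  "NS \<Sigma> W = - {s - b | s b. s \<in> star \<Sigma> ` Gam \<Sigma> \<and> b \<in> frontier W}"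

definition language :: "'a::real_normed_vector set \<Rightarrow> 'a set set" where
  "language \<Lambda> = {(\<lambda>y. y - x) ` \<Lambda> \<inter> ball 0 R | x R. x \<in> \<Lambda> \<and> R > 0}"

text \<open>
  All nonsingular model sets of a cut and project scheme with a window have the same language, so
  the description below denotes that common language.
\<close>

definition language_NS ::
    "('h::{topological_ab_group_add, t2_space} \<times> (real ^ 'd)) set \<Rightarrow> 'h set \<Rightarrow> (real ^ 'd) set set" where
  "language_NS \<Sigma> W =
     (THE L. \<forall>w \<in> NS \<Sigma> W. \<forall>t. language ((\<lambda>y. y - t) ` proj_set \<Sigma> ((+) w ` W)) = L)"

definition cps_hull ::
    "('h::{topological_ab_group_add, t2_space} \<times> (real ^ 'd)) set \<Rightarrow> 'h set \<Rightarrow> (real ^ 'd) set set" where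
  "cps_hull \<Sigma> W = {\<Lambda>. language \<Lambda> = language_NS \<Sigma> W}"

section \<open>The internal system\<close>

definition internal ::
    "('h::{topological_ab_group_add, t2_space} \<times> (real ^ 'd)) set \<Rightarrow> 'h set \<Rightarrow> (real ^ 'd) set set" where
  "internal \<Sigma> W = {\<Lambda> \<in> cps_hull \<Sigma> W. \<Lambda> \<subseteq> Gam \<Sigma>}"

text \<open>
  The sets \<open>{\<Lambda>' \<in> internal \<Sigma> W. \<Lambda>' \<inter> K = \<Lambda> \<inter> K}\<close>, with \<open>K\<close> compact, form a neighbourhood basis
  of \<open>\<Lambda>\<close>.
\<close>

definition internal_topology ::
    "('h::{topological_ab_group_add, t2_space} \<times> (real ^ 'd)) set \<Rightarrow> 'h set \<Rightarrow> (real ^ 'd) set topology" where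
  "internal_topology \<Sigma> W =
     topology (\<lambda>U. U \<subseteq> internal \<Sigma> W \<and>
       (\<forall>\<Lambda>\<in>U. \<exists>K. compact K \<and> {\<Lambda>' \<in> internal \<Sigma> W. \<Lambda> \<inter> K = \<Lambda>' \<inter> K} \<subseteq> U))"

text \<open>
  The map \<open>\<Pi>\<close> onto \<open>H\<close>. Uniqueness of \<open>w\<close> comes from density of the star image of \<open>\<Sigma>\<close> and
  irredundancy of the window.
\<close>

definition internal_param ::
    "('h::{topological_ab_group_add, t2_space} \<times> (real ^ 'd)) set \<Rightarrow> 'h set \<Rightarrow> (real ^ 'd) set \<Rightarrow> 'h" where
  "internal_param \<Sigma> W \<Lambda> =
     (THE w. proj_set \<Sigma> ((+) w ` interior W) \<subseteq> \<Lambda> \<and> \<Lambda> \<subseteq> proj_set \<Sigma> ((+) w ` W))"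

section \<open>The Ellis semigroup\<close>

text \<open>
  Self-maps of the internal system are represented as extensional functions, so that they form the
  carrier of the product topology. Maps act on the right: \<open>x.g\<close> is \<open>g x\<close>, hence
  \<open>x.(g.h) = (x.g).h\<close> makes \<open>g.h\<close> the map ``first \<open>g\<close>, then \<open>h\<close>''.
\<close>

definition Gam_act ::
    "('h::{topological_ab_group_add, t2_space} \<times> (real ^ 'd)) set \<Rightarrow> 'h set \<Rightarrow> real ^ 'd
      \<Rightarrow> (real ^ 'd) set \<Rightarrow> (real ^ 'd) set" where
  "Gam_act \<Sigma> W \<gamma> = (\<lambda>\<Lambda> \<in> internal \<Sigma> W. (\<lambda>x. x + \<gamma>) ` \<Lambda>)"

abbreviation pointwise_topology ::
    "('h::{topological_ab_group_add, t2_space} \<times> (real ^ 'd)) set \<Rightarrow> 'h set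
      \<Rightarrow> ((real ^ 'd) set \<Rightarrow> (real ^ 'd) set) topology" where
  "pointwise_topology \<Sigma> W \<equiv> product_topology (\<lambda>_. internal_topology \<Sigma> W) (internal \<Sigma> W)"

definition ellis ::
    "('h::{topological_ab_group_add, t2_space} \<times> (real ^ 'd)) set \<Rightarrow> 'h set
      \<Rightarrow> ((real ^ 'd) set \<Rightarrow> (real ^ 'd) set) set" where
  "ellis \<Sigma> W = pointwise_topology \<Sigma> W closure_of (Gam_act \<Sigma> W ` Gam \<Sigma>)"

definition ellis_topology ::
    "('h::{topological_ab_group_add, t2_space} \<times> (real ^ 'd)) set \<Rightarrow> 'h set
      \<Rightarrow> ((real ^ 'd) set \<Rightarrow> (real ^ 'd) set) topology" where
  "ellis_topology \<Sigma> W = subtopology (pointwise_topology \<Sigma> W) (ellis \<Sigma> W)"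

definition ellis_mult ::
    "('h::{topological_ab_group_add, t2_space} \<times> (real ^ 'd)) set \<Rightarrow> 'h set
      \<Rightarrow> ((real ^ 'd) set \<Rightarrow> (real ^ 'd) set) \<Rightarrow> ((real ^ 'd) set \<Rightarrow> (real ^ 'd) set)
      \<Rightarrow> ((real ^ 'd) set \<Rightarrow> (real ^ 'd) set)" where
  "ellis_mult \<Sigma> W g h = compose (internal \<Sigma> W) h g"

section \<open>The topologies and the semigroup are well defined\<close>

lemma openin_coset_topology:
  fixes S :: "'a::{ab_group_add, topological_space} set"
  shows "openin (coset_topology S) U \<longleftrightarrow>
           U \<subseteq> range (\<lambda>x. (+) x ` S) \<and> open {x. (+) x ` S \<in> U}"
proof -
  let ?P = "\<lambda>U. U \<subseteq> range (\<lambda>x. (+) x ` S) \<and> open {x. (+) x ` S \<in> U}"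
  have "istopology ?P"
    unfolding istopology_def
  proof (intro conjI allI impI)
    fix U V assume "?P U" "?P V"
    moreover have "{x. (+) x ` S \<in> U \<inter> V} = {x. (+) x ` S \<in> U} \<inter> {x. (+) x ` S \<in> V}" by auto
    ultimately show "U \<inter> V \<subseteq> range (\<lambda>x. (+) x ` S)" "open {x. (+) x ` S \<in> U \<inter> V}" by auto
  next
    fix \<U> assume *: "\<forall>U\<in>\<U>. ?P U"
    then show "\<Union>\<U> \<subseteq> range (\<lambda>x. (+) x ` S)" by blast
    have "{x. (+) x ` S \<in> \<Union>\<U>} = (\<Union>U\<in>\<U>. {x. (+) x ` S \<in> U})" by auto
    with * show "open {x. (+) x ` S \<in> \<Union>\<U>}" by auto
  qed
  then show ?thesis
    unfolding coset_topology_def by (simp add: topology_inverse')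
qed

lemma quotient_map_coset_topology:
  fixes S :: "'a::{ab_group_add, topological_space} set"
  shows "quotient_map euclidean (coset_topology S) (\<lambda>x. (+) x ` S)"
proof -
  have "openin (coset_topology S) (range (\<lambda>x. (+) x ` S))"
    by (simp add: openin_coset_topology)
  then have "topspace (coset_topology S) = range (\<lambda>x. (+) x ` S)"
    by (metis openin_coset_topology openin_subset openin_topspace subset_antisym)
  then show ?thesis
    by (auto simp: quotient_map_def openin_coset_topology)
qed

lemma openin_internal_topology:
  "openin (internal_topology \<Sigma> W) U \<longleftrightarrow>
     U \<subseteq> internal \<Sigma> W \<and>
     (\<forall>\<Lambda>\<in>U. \<exists>K. compact K \<and> {\<Lambda>' \<in> internal \<Sigma> W. \<Lambda> \<inter> K = \<Lambda>' \<inter> K} \<subseteq> U)"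
proof -
  let ?N = "\<lambda>\<Lambda> K. {\<Lambda>' \<in> internal \<Sigma> W. \<Lambda> \<inter> K = \<Lambda>' \<inter> K}"
  let ?P = "\<lambda>U. U \<subseteq> internal \<Sigma> W \<and> (\<forall>\<Lambda>\<in>U. \<exists>K. compact K \<and> ?N \<Lambda> K \<subseteq> U)"
  have "istopology ?P"
    unfolding istopology_def
  proof (intro conjI allI impI ballI)
    fix U V assume U: "?P U" and V: "?P V"
    from U show "U \<inter> V \<subseteq> internal \<Sigma> W" by auto
    fix \<Lambda> assume "\<Lambda> \<in> U \<inter> V"
    then have \<Lambda>: "\<Lambda> \<in> U" "\<Lambda> \<in> V" by auto
    obtain K where K: "compact K" "?N \<Lambda> K \<subseteq> U"
      using bspec[OF conjunct2[OF U] \<Lambda>(1)] by (elim exE conjE)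
    obtain L where L: "compact L" "?N \<Lambda> L \<subseteq> V"
      using bspec[OF conjunct2[OF V] \<Lambda>(2)] by (elim exE conjE)
    have "?N \<Lambda> (K \<union> L) \<subseteq> ?N \<Lambda> K" "?N \<Lambda> (K \<union> L) \<subseteq> ?N \<Lambda> L" by blast+
    with K(2) L(2) have "?N \<Lambda> (K \<union> L) \<subseteq> U \<inter> V"
      by (intro Int_greatest) (rule order_trans, assumption+)+
    with compact_Un[OF K(1) L(1)] show "\<exists>K. compact K \<and> ?N \<Lambda> K \<subseteq> U \<inter> V"
      by (intro exI conjI)
  next
    fix \<U> assume *: "\<forall>U\<in>\<U>. ?P U"
    then show "\<Union>\<U> \<subseteq> internal \<Sigma> W" by (intro Union_least) simp
    fix \<Lambda> assume "\<Lambda> \<in> \<Union>\<U>"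
    then obtain U where U: "U \<in> \<U>" "\<Lambda> \<in> U" by (rule UnionE)
    obtain K where K: "compact K" "?N \<Lambda> K \<subseteq> U"
      using bspec[OF conjunct2[OF bspec[OF * U(1)]] U(2)] by (elim exE conjE)
    show "\<exists>K. compact K \<and> ?N \<Lambda> K \<subseteq> \<Union>\<U>"
      using K(1) order_trans[OF K(2) Union_upper[OF U(1)]] by (intro exI conjI)
  qed
  then show ?thesis
    unfolding internal_topology_def by (simp add: topology_inverse')
qed

lemma topspace_internal_topology [simp]: "topspace (internal_topology \<Sigma> W) = internal \<Sigma> W"
proof -
  have "openin (internal_topology \<Sigma> W) (internal \<Sigma> W)"
    by (auto simp: openin_internal_topology)
  then show ?thesis
    by (metis openin_internal_topology openin_subset openin_topspace subset_antisym)
qed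

lemma language_translate: "language ((\<lambda>x. x + t) ` \<Lambda>) = language \<Lambda>"
proof -
  have *: "(\<lambda>y. y - (x + t)) ` (\<lambda>x. x + t) ` \<Lambda> = (\<lambda>y. y - x) ` \<Lambda>" for x
    by (simp add: image_image)
  have L: "language M = (\<Union>x\<in>M. \<Union>R\<in>{0<..}. {(\<lambda>y. y - x) ` M \<inter> ball 0 R})"
    for M :: "'a set"
    unfolding language_def by auto
  show ?thesis
    unfolding L UN_simps(10) * ..
qed

lemma add_subgroup_Gam:
  fixes \<Sigma> :: "('h::{topological_ab_group_add, t2_space} \<times> (real ^ 'd)) set"
  assumes "cut_and_project_scheme \<Sigma>"
  shows "add_subgroup (Gam \<Sigma>)"
  unfolding add_subgroup_def
proof (intro conjI ballI)
  have S: "add_subgroup \<Sigma>" using assms by (simp add: cut_and_project_scheme_def)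
  then have "snd (0 :: 'h \<times> (real ^ 'd)) \<in> Gam \<Sigma>"
    unfolding Gam_def add_subgroup_def by (intro imageI) blast
  then show "0 \<in> Gam \<Sigma>" by simp
  fix x assume "x \<in> Gam \<Sigma>"
  then obtain p where p: "p \<in> \<Sigma>" "x = snd p" unfolding Gam_def by blast
  with S have "snd (- p) \<in> Gam \<Sigma>"
    unfolding Gam_def add_subgroup_def by (intro imageI) blast
  then show "- x \<in> Gam \<Sigma>" by (simp add: p)
  fix y assume "y \<in> Gam \<Sigma>"
  then obtain q where q: "q \<in> \<Sigma>" "y = snd q" unfolding Gam_def by blast
  with S p have "snd (p + q) \<in> Gam \<Sigma>"
    unfolding Gam_def add_subgroup_def by (intro imageI) blast
  then show "x + y \<in> Gam \<Sigma>" by (simp add: p q)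
qed

lemma translate_internal:
  fixes \<Sigma> :: "('h::{topological_ab_group_add, t2_space} \<times> (real ^ 'd)) set"
  assumes "cut_and_project_scheme \<Sigma>" "\<gamma> \<in> Gam \<Sigma>" "\<Lambda> \<in> internal \<Sigma> W"
  shows "(\<lambda>x. x + \<gamma>) ` \<Lambda> \<in> internal \<Sigma> W"
proof -
  have "x + \<gamma> \<in> Gam \<Sigma>" if "x \<in> \<Lambda>" for x
    using add_subgroup_Gam[OF assms(1)] assms(2,3) that
    unfolding add_subgroup_def internal_def by blast
  then show ?thesis
    using assms(3) by (auto simp: internal_def cps_hull_def language_translate)
qed

lemma continuous_map_Gam_act:
  fixes \<Sigma> :: "('h::{topological_ab_group_add, t2_space} \<times> (real ^ 'd)) set"
  assumes "cut_and_project_scheme \<Sigma>" "\<gamma> \<in> Gam \<Sigma>"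
  shows "continuous_map (internal_topology \<Sigma> W) (internal_topology \<Sigma> W) (Gam_act \<Sigma> W \<gamma>)"
proof -
  let ?\<Xi> = "internal \<Sigma> W"
  let ?t = "\<lambda>\<Lambda>. (\<lambda>x. x + \<gamma>) ` \<Lambda>"
  have in\<Xi>: "?t \<Lambda> \<in> ?\<Xi>" if "\<Lambda> \<in> ?\<Xi>" for \<Lambda>
    using translate_internal[OF assms that] .
  have "openin (internal_topology \<Sigma> W) {\<Lambda> \<in> ?\<Xi>. ?t \<Lambda> \<in> U}"
    if U: "openin (internal_topology \<Sigma> W) U" for U
    unfolding openin_internal_topology
  proof (intro conjI ballI)
    fix \<Lambda> assume "\<Lambda> \<in> {\<Lambda> \<in> ?\<Xi>. ?t \<Lambda> \<in> U}"
    then obtain K where K: "compact K" "{\<Lambda>' \<in> ?\<Xi>. ?t \<Lambda> \<inter> K = \<Lambda>' \<inter> K} \<subseteq> U"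
      using U unfolding openin_internal_topology by blast
    let ?K = "(\<lambda>x. x - \<gamma>) ` K"
    have tK: "?t (M \<inter> ?K) = ?t M \<inter> K" for M
      by (force simp: image_iff)
    have "compact ?K"
      using K(1) by (intro compact_continuous_image continuous_intros)
    moreover have "?t \<Lambda>' \<in> U" if "\<Lambda>' \<in> ?\<Xi>" "\<Lambda> \<inter> ?K = \<Lambda>' \<inter> ?K" for \<Lambda>'
    proof -
      have "?t \<Lambda> \<inter> K = ?t \<Lambda>' \<inter> K"
        using tK[of \<Lambda>] tK[of \<Lambda>'] that(2) by simp
      with K(2) in\<Xi>[OF that(1)] show ?thesis by blast
    qed
    ultimately show "\<exists>K. compact K \<and>
        {\<Lambda>' \<in> ?\<Xi>. \<Lambda> \<inter> K = \<Lambda>' \<inter> K} \<subseteq> {\<Lambda> \<in> ?\<Xi>. ?t \<Lambda> \<in> U}"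
      by (intro exI[of _ ?K]) auto
  qed auto
  then have "continuous_map (internal_topology \<Sigma> W) (internal_topology \<Sigma> W) ?t"
    using in\<Xi> by (auto simp: continuous_map_def)
  then show ?thesis
    by (rule continuous_map_eq) (simp add: Gam_act_def)
qed

proposition ellis_mult_closed:
  fixes \<Sigma> :: "('h::{topological_ab_group_add, t2_space} \<times> (real ^ 'd)) set"
  assumes \<Sigma>: "cut_and_project_scheme \<Sigma>" and g: "g \<in> ellis \<Sigma> W" and h: "h \<in> ellis \<Sigma> W"
  shows "ellis_mult \<Sigma> W g h \<in> ellis \<Sigma> W"
proof -
  let ?\<Xi> = "internal \<Sigma> W" and ?T = "internal_topology \<Sigma> W"
  let ?Y = "pointwise_topology \<Sigma> W" and ?A = "Gam_act \<Sigma> W ` Gam \<Sigma>"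
  have AY: "?A \<subseteq> topspace ?Y"
    using translate_internal[OF \<Sigma>] by (auto simp: Gam_act_def)
  have E: "ellis \<Sigma> W = ?Y closure_of ?A" by (simp add: ellis_def)
  have EY: "ellis \<Sigma> W \<subseteq> topspace ?Y"
    unfolding E by (rule closure_of_subset_topspace)
  have AE: "?A \<subseteq> ellis \<Sigma> W"
    unfolding E by (rule closure_of_subset[OF AY])
  have 1: "compose ?\<Xi> a k \<in> ellis \<Sigma> W" if a: "a \<in> ?A" and k: "k \<in> ellis \<Sigma> W" for a k
  proof -
    have contT: "continuous_map ?T ?T a"
      using a continuous_map_Gam_act[OF \<Sigma>] by auto
    have "continuous_map ?Y ?T (\<lambda>k. a (k \<Lambda>))" if "\<Lambda> \<in> ?\<Xi>" for \<Lambda>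
      using continuous_map_compose[OF continuous_map_product_projection[OF that] contT]
      by (simp add: o_def)
    then have "continuous_map ?Y ?Y (compose ?\<Xi> a)"
      by (auto simp: continuous_map_componentwise compose_def)
    then have "compose ?\<Xi> a ` ellis \<Sigma> W \<subseteq> ?Y closure_of (compose ?\<Xi> a ` ?A)"
      unfolding E by (rule continuous_map_image_closure_subset)
    moreover have "compose ?\<Xi> a ` ?A \<subseteq> ?A"
    proof clarify
      fix \<beta> assume \<beta>: "\<beta> \<in> Gam \<Sigma>"
      obtain \<alpha> where \<alpha>: "\<alpha> \<in> Gam \<Sigma>" "a = Gam_act \<Sigma> W \<alpha>" using a by auto
      have "compose ?\<Xi> a (Gam_act \<Sigma> W \<beta>) = Gam_act \<Sigma> W (\<beta> + \<alpha>)"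
        using translate_internal[OF \<Sigma> \<beta>]
        by (auto simp: compose_def Gam_act_def \<alpha> image_image add.assoc intro!: restrict_ext)
      moreover have "\<beta> + \<alpha> \<in> Gam \<Sigma>"
        using add_subgroup_Gam[OF \<Sigma>] \<alpha> \<beta> by (simp add: add_subgroup_def)
      ultimately show "compose ?\<Xi> a (Gam_act \<Sigma> W \<beta>) \<in> ?A" by simp
    qed
    ultimately show ?thesis
      using k closure_of_mono[of "compose ?\<Xi> a ` ?A" ?A ?Y] unfolding E by blast
  qed
  have g\<Xi>: "g \<Lambda> \<in> ?\<Xi>" if "\<Lambda> \<in> ?\<Xi>" for \<Lambda>
    using g EY that by (auto simp: PiE_iff subset_iff)
  have "continuous_map ?Y ?Y (\<lambda>k. compose ?\<Xi> k g)"
    using g\<Xi> by (auto simp: continuous_map_componentwise compose_def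
                     intro!: continuous_map_product_projection)
  then have "(\<lambda>k. compose ?\<Xi> k g) ` ellis \<Sigma> W \<subseteq> ?Y closure_of ((\<lambda>k. compose ?\<Xi> k g) ` ?A)"
    unfolding E by (rule continuous_map_image_closure_subset)
  also have "\<dots> \<subseteq> ?Y closure_of (ellis \<Sigma> W)"
    using 1 g by (intro closure_of_mono) auto
  also have "\<dots> = ellis \<Sigma> W"
    by (simp add: E)
  finally show ?thesis
    using h by (auto simp: ellis_mult_def)
qed

lemma topspace_ellis_topology [simp]: "topspace (ellis_topology \<Sigma> W) = ellis \<Sigma> W"
  unfolding ellis_topology_def ellis_def
  by (simp add: closure_of_subset_topspace Int_absorb1 del: topspace_product_topology)

end

(*
  The parametrization Pi of the internal system is continuous with compact preimages of compact
  sets, because a model set confines its parameter to a compact set and is sandwiched between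
  the model sets of an open and a closed window, a closed condition that determines the
  parameter. For gamma in Gamma, Pi (Lambda + gamma) - Pi Lambda = star gamma does not depend on
  Lambda; by continuity and density, Pi (g Lambda) - Pi Lambda does not depend on Lambda for any
  g in the Ellis semigroup either, and this difference is the required morphism. The preimage of
  a compact set is a closed subset of a product of Pi-preimages of compact sets, hence compact by
  Tychonoff. So the morphism is proper, and its image is closed and contains the dense group
  star Gamma.
*)
theory Submission
  imports Defs
begin

section \<open>Discrete subgroups and translates\<close>

text \<open>Continuity of subtraction gives each \<open>k\<close> a neighbourhood \<open>V k\<close>
  all of whose differences lie in \<open>T\<close>, and \<open>T\<close> meets \<open>S\<close> only
  in \<open>0\<close>. So \<open>V k\<close> contains at most one point of \<open>S\<close>, and
  finitely many \<open>V k\<close> cover \<open>K\<close>.\<close>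

lemma finite_discrete_subgroup_Int_compact:
  fixes S K :: "'a::{group_add, topological_space} set"
  assumes S: "add_subgroup S" "discrete S" and K: "compact K"
    and cont: "continuous_on UNIV (\<lambda>p::'a \<times> 'a. fst p - snd p)"
  shows "finite (S \<inter> K)"
proof -
  have diff: "x - y \<in> S" if "x \<in> S" "y \<in> S" for x y
    using S(1) that unfolding add_subgroup_def by (metis diff_conv_add_uminus)
  have "0 \<in> S" using S(1) by (simp add: add_subgroup_def)
  then obtain T where T: "open T" "T \<inter> S = {0}"
    using S(2) unfolding discrete_def isolated_in_def by blast
  let ?D = "(\<lambda>p::'a \<times> 'a. fst p - snd p) -` T"
  have "\<exists>V. open V \<and> k \<in> V \<and> V \<times> V \<subseteq> ?D" for k
  proof -
    have "open ?D" using cont T(1) by (rule open_vimage[rotated])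
    moreover have "(k, k) \<in> ?D" using T(2) by auto
    ultimately obtain A B where "open A" "open B" "(k, k) \<in> A \<times> B" "A \<times> B \<subseteq> ?D"
      by (rule open_prod_elim)
    then show ?thesis by (intro exI[of _ "A \<inter> B"]) auto
  qed
  then obtain V where V: "\<And>k. open (V k)" "\<And>k. k \<in> V k" "\<And>k. V k \<times> V k \<subseteq> ?D"
    by metis
  have "finite (S \<inter> V k)" for k
  proof -
    have "x = y" if xy: "x \<in> S \<inter> V k" "y \<in> S \<inter> V k" for x y
    proof -
      have "x - y \<in> T" using V(3)[of k] xy by auto
      moreover have "x - y \<in> S" using diff xy by auto
      ultimately show "x = y" using T(2) by (metis IntI eq_iff_diff_eq_0 singletonD)
    qed
    then have "S \<inter> V k = {} \<or> (\<exists>x. S \<inter> V k = {x})" by blast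
    then show ?thesis by auto
  qed
  moreover obtain F where "finite F" "K \<subseteq> (\<Union>k\<in>F. V k)"
    by (rule compactE_image[OF K, of K V]) (use V in auto)
  ultimately have "finite (\<Union>k\<in>F. S \<inter> V k)" by blast
  then show ?thesis
    by (rule rev_finite_subset) (use \<open>K \<subseteq> _\<close> in blast)
qed

lemma mem_translate_iff: "x \<in> (+) w ` A \<longleftrightarrow> x - w \<in> A" for x w :: "'a::ab_group_add"
  by (force simp: image_iff algebra_simps)

lemma closed_diff_left: "closed {w. c - w \<in> A}" if "closed A"
  for A :: "'a::topological_ab_group_add set"
proof -
  have "continuous_on UNIV (\<lambda>w. c - w)" by (intro continuous_intros)
  then show ?thesis using closed_vimage[OF that] by (simp add: vimage_def)
qed

lemma open_diff_left: "open {w. c - w \<in> A}" if "open A"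
  for A :: "'a::topological_ab_group_add set"
  using closed_diff_left[of "- A" c] that by (simp add: closed_def Collect_neg_eq)

lemma compact_diff_left: "compact {w. c - w \<in> A}" if "compact A"
  for A :: "'a::topological_ab_group_add set"
proof -
  have "{w. c - w \<in> A} = (\<lambda>w. c - w) ` A" by force
  then show ?thesis
    using that by (auto intro!: compact_continuous_image continuous_intros)
qed

lemma compact_set_plus: "compact ((\<lambda>(x, y). x + y) ` (A \<times> B))" if "compact A" "compact B"
  for A B :: "'a::topological_ab_group_add set"
  using compact_Times[OF that]
  by (intro compact_continuous_image) (auto simp: split_def intro!: continuous_intros)

lemma Hausdorff_space_euclidean_t2: "Hausdorff_space (euclidean :: 'a::t2_space topology)"
  unfolding Hausdorff_space_def disjnt_def by (metis hausdorff open_openin)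

text \<open>The nowhere density that feeds the Baire argument in \<open>NS_nonempty\<close>.\<close>

lemma interior_frontier_closed: "interior (frontier A) = {}" if "closed A"
proof -
  have "interior (frontier A) \<subseteq> interior A"
    using that by (intro interior_mono) (simp add: frontier_subset_closed)
  moreover have "interior (frontier A) \<inter> interior A = {}"
    using interior_subset[of "frontier A"] by (auto simp: frontier_def)
  ultimately show ?thesis by blast
qed

lemma language_altdef: "language A = {{z \<in> ball 0 R. x + z \<in> A} | x R. x \<in> A \<and> R > 0}"
proof -
  have "(\<lambda>y. y - x) ` A \<inter> ball 0 R = {z \<in> ball 0 R. x + z \<in> A}" for x R
    by (force simp: image_iff algebra_simps)
  then show ?thesis by (simp add: language_def)
qed

text \<open>A patch of \<open>A\<close> of radius \<open>R\<close> at \<open>x\<close> only sees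
  points of \<open>ball 0 (norm x + R)\<close>, so matching \<open>A\<close> with translates of
  \<open>B\<close> on balls around the origin suffices.\<close>

lemma language_subsetI:
  assumes "\<And>R. \<exists>t. \<forall>y\<in>ball 0 R. y \<in> A \<longleftrightarrow> y + t \<in> B"
  shows "language A \<subseteq> language B"
proof -
  have "{z \<in> ball 0 R. x + z \<in> A} \<in> language B" if "x \<in> A" "R > 0" for x R
  proof -
    obtain t where t: "\<And>y. y \<in> ball 0 (norm x + R) \<Longrightarrow> y \<in> A \<longleftrightarrow> y + t \<in> B"
      using assms by blast
    have "x + t \<in> B" using t[of x] that by simp
    moreover have "x + z \<in> A \<longleftrightarrow> x + t + z \<in> B" if "z \<in> ball 0 R" for z
      using t[of "x + z"] norm_triangle_ineq[of x z] that by (simp add: algebra_simps)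
    then have "{z \<in> ball 0 R. x + z \<in> A} = {z \<in> ball 0 R. x + t + z \<in> B}" by blast
    ultimately show ?thesis using \<open>R > 0\<close> unfolding language_altdef by blast
  qed
  then show ?thesis by (auto simp: language_altdef[of A])
qed

lemma language_eq_empty_iff [simp]: "language A = {} \<longleftrightarrow> A = {}"
proof
  show "A = {}" if "language A = {}"
  proof (rule equals0I)
    fix x assume "x \<in> A"
    then have "(\<lambda>y. y - x) ` A \<inter> ball 0 1 \<in> language A"
      unfolding language_def using zero_less_one by blast
    with that show False by simp
  qed
qed (simp add: language_def)

section \<open>Model sets\<close>

text \<open>The empty set satisfies \<open>window\<close> when \<open>H\<close> is trivial; that
  case is treated separately in the final theorem.\<close>

locale cps_window =
  fixes \<Sigma> :: "('h::{topological_ab_group_add, t2_space} \<times> (real ^ 'd)) set" and W :: "'h set"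
  assumes cps: "cut_and_project_scheme \<Sigma>" and window: "window W" and W_nonempty: "W \<noteq> {}"
begin

abbreviation "\<Gamma> \<equiv> Gam \<Sigma>"

lemma subgroup_\<Sigma>: "add_subgroup \<Sigma>"
  using cps by (simp add: cut_and_project_scheme_def)

lemma locally_compact_H: "locally_compact_space (euclidean :: 'h topology)"
  using cps by (simp add: cut_and_project_scheme_def)

lemma compact_W: "compact W"
  using window by (simp add: window_def)

lemma closed_W: "closed W"
  using compact_W by (rule compact_imp_closed)

lemma star_eqI: "(h, \<gamma>) \<in> \<Sigma> \<Longrightarrow> star \<Sigma> \<gamma> = h"
  using cps unfolding star_def cut_and_project_scheme_def
  by (intro the_equality) (auto dest: inj_onD[of snd \<Sigma> "(_, \<gamma>)" "(h, \<gamma>)"])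

lemma star_in: "\<gamma> \<in> \<Gamma> \<Longrightarrow> (star \<Sigma> \<gamma>, \<gamma>) \<in> \<Sigma>"
  by (auto simp: Gam_def star_eqI)

lemma star_add:
  assumes "\<gamma> \<in> \<Gamma>" "\<delta> \<in> \<Gamma>" shows "star \<Sigma> (\<gamma> + \<delta>) = star \<Sigma> \<gamma> + star \<Sigma> \<delta>"
proof -
  have "(star \<Sigma> \<gamma>, \<gamma>) + (star \<Sigma> \<delta>, \<delta>) \<in> \<Sigma>"
    using subgroup_\<Sigma> assms[THEN star_in] unfolding add_subgroup_def by blast
  then show ?thesis by (simp add: star_eqI)
qed

lemma star_image: "star \<Sigma> ` \<Gamma> = fst ` \<Sigma>"
  by (force simp: Gam_def star_eqI image_iff)

lemma \<Gamma>_zero: "0 \<in> \<Gamma>" and \<Gamma>_add: "x \<in> \<Gamma> \<Longrightarrow> y \<in> \<Gamma> \<Longrightarrow> x + y \<in> \<Gamma>"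
  and \<Gamma>_minus: "x \<in> \<Gamma> \<Longrightarrow> - x \<in> \<Gamma>"
  using add_subgroup_Gam[OF cps] by (auto simp: add_subgroup_def)

lemma \<Gamma>_add_iff: "\<gamma> \<in> \<Gamma> \<Longrightarrow> x + \<gamma> \<in> \<Gamma> \<longleftrightarrow> x \<in> \<Gamma>"
  by (metis \<Gamma>_add \<Gamma>_minus add_diff_cancel diff_conv_add_uminus)

lemma star_minus: "\<gamma> \<in> \<Gamma> \<Longrightarrow> star \<Sigma> (- \<gamma>) = - star \<Sigma> \<gamma>"
  using star_add[of \<gamma> "- \<gamma>"] star_add[OF \<Gamma>_zero \<Gamma>_zero] \<Gamma>_minus
  by (simp add: minus_unique)

lemma star_dense: "open U \<Longrightarrow> U \<noteq> {} \<Longrightarrow> \<exists>\<gamma>\<in>\<Gamma>. star \<Sigma> \<gamma> \<in> U"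
  using cps open_Int_closure_eq_empty[of U "fst ` \<Sigma>"]
  by (auto simp: cut_and_project_scheme_def simp flip: star_image)

lemma mem_model_set: "\<gamma> \<in> proj_set \<Sigma> ((+) w ` A) \<longleftrightarrow> \<gamma> \<in> \<Gamma> \<and> star \<Sigma> \<gamma> - w \<in> A"
  by (auto simp: proj_set_def mem_translate_iff)

text \<open>Local finiteness, from discreteness of \<open>\<Sigma>\<close>: this is what reduces
  agreement on a compact set to agreement at finitely many points.\<close>

lemma finite_proj_set_Int:
  assumes "compact K" "compact B" shows "finite (proj_set \<Sigma> K \<inter> B)"
proof -
  have "continuous_on UNIV (\<lambda>p::('h \<times> (real ^ 'd)) \<times> 'h \<times> (real ^ 'd). fst p - snd p)"
    by (auto simp: minus_prod_def intro!: continuous_intros)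
  then have "finite (\<Sigma> \<inter> K \<times> B)"
    using finite_discrete_subgroup_Int_compact[OF subgroup_\<Sigma> _ compact_Times[OF assms]] cps
    by (simp add: cut_and_project_scheme_def)
  moreover have "proj_set \<Sigma> K \<inter> B \<subseteq> snd ` (\<Sigma> \<inter> K \<times> B)"
    using star_in by (force simp: proj_set_def image_iff)
  ultimately show ?thesis by (meson finite_imageI finite_subset)
qed

lemma interior_W_nonempty: "interior W \<noteq> {}"
  using window W_nonempty by (auto simp: window_def)

section \<open>Nonsingular parameters\<close>

lemma NS_iff: "w \<in> NS \<Sigma> W \<longleftrightarrow> (\<forall>\<gamma>\<in>\<Gamma>. star \<Sigma> \<gamma> - w \<notin> frontier W)"
proof -
  have "w = s - b \<longleftrightarrow> b = s - w" for s b by (auto simp: algebra_simps)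
  then show ?thesis by (auto simp: NS_def)
qed

lemma NS_interior: "w \<in> NS \<Sigma> W \<Longrightarrow> \<gamma> \<in> \<Gamma> \<Longrightarrow> star \<Sigma> \<gamma> - w \<in> W \<Longrightarrow> star \<Sigma> \<gamma> - w \<in> interior W"
  using closed_W by (auto simp: NS_iff frontier_def)

lemma NS_translate:
  assumes "w \<in> NS \<Sigma> W" "\<gamma> \<in> \<Gamma>" shows "w + star \<Sigma> \<gamma> \<in> NS \<Sigma> W"
  unfolding NS_iff
proof
  fix \<delta> assume \<delta>: "\<delta> \<in> \<Gamma>"
  have "star \<Sigma> \<delta> - (w + star \<Sigma> \<gamma>) = star \<Sigma> (\<delta> + - \<gamma>) - w"
    using star_add[OF \<delta> \<Gamma>_minus[OF assms(2)]] star_minus[OF assms(2)] by simp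
  moreover have "\<delta> + - \<gamma> \<in> \<Gamma>"
    using \<delta> assms(2) by (intro \<Gamma>_add \<Gamma>_minus)
  ultimately show "star \<Sigma> \<delta> - (w + star \<Sigma> \<gamma>) \<notin> frontier W"
    using assms(1) by (simp only: NS_iff not_False_eq_True)
qed

text \<open>The complement is the union, over the countable group \<open>\<Gamma>\<close>, of
  reflected translates of \<open>frontier W\<close>. These are closed with empty interior, and the
  locally compact Hausdorff group \<open>H\<close> is a Baire space.\<close>

lemma NS_nonempty: "NS \<Sigma> W \<noteq> {}"
proof -
  let ?B = "\<lambda>\<gamma>. {w. star \<Sigma> \<gamma> - w \<in> frontier W}"
  have "interior (?B \<gamma>) = {}" for \<gamma>
  proof -
    let ?V = "{v. star \<Sigma> \<gamma> - v \<in> interior (?B \<gamma>)}"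
    have "?V \<subseteq> interior (frontier W)"
    proof (rule interior_maximal)
      show "open ?V" by (rule open_diff_left) simp
      show "?V \<subseteq> frontier W" using interior_subset[of "?B \<gamma>"] by auto
    qed
    then have "?V = {}" by (simp add: interior_frontier_closed closed_W)
    moreover have "v \<in> interior (?B \<gamma>) \<Longrightarrow> star \<Sigma> \<gamma> - v \<in> ?V" for v by simp
    ultimately show ?thesis by blast
  qed
  moreover have "closed (?B \<gamma>)" for \<gamma>
    by (rule closed_diff_left) simp
  moreover have "countable \<Gamma>"
    using cps by (simp add: cut_and_project_scheme_def Gam_def)
  ultimately have "euclidean interior_of \<Union>(?B ` \<Gamma>) = {}"
    using locally_compact_H locally_compact_Hausdorff_imp_regular_space[OF _ Hausdorff_space_euclidean_t2]
    by (intro Baire_category_alt) auto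
  moreover have "- NS \<Sigma> W = \<Union>(?B ` \<Gamma>)" by (auto simp: NS_iff)
  ultimately have "- NS \<Sigma> W \<noteq> UNIV" by auto
  then show ?thesis by auto
qed

text \<open>The boxes \<open>U \<times> ball 0 n\<close> have open images in the quotient by
  \<open>\<Sigma>\<close>, and by density of the star image these increase to the whole quotient.
  Cocompactness yields a single \<open>n\<close>; applied to the cosets of \<open>(0, x)\<close> it
  gives the claim.\<close>

lemma proj_set_relatively_dense:
  assumes "open U" "U \<noteq> {}"
  obtains n where "\<And>x. \<exists>\<gamma>\<in>proj_set \<Sigma> U. norm (x + \<gamma>) < n"
proof -
  let ?c = "\<lambda>x. (+) x ` \<Sigma>"
  let ?O = "\<lambda>n::nat. ?c ` (U \<times> ball 0 (real n))"
  have coset: "?c x \<in> ?c ` A \<longleftrightarrow> (\<exists>s\<in>\<Sigma>. x + s \<in> A)" for x A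
  proof
    assume "?c x \<in> ?c ` A"
    then obtain a where a: "a \<in> A" "?c x = ?c a" by blast
    have "0 \<in> \<Sigma>" using subgroup_\<Sigma> by (simp add: add_subgroup_def)
    then have "a + 0 \<in> ?c x" unfolding a(2) by (rule imageI)
    then have "a - x \<in> \<Sigma>" by (simp add: mem_translate_iff)
    with a(1) show "\<exists>s\<in>\<Sigma>. x + s \<in> A" by (intro bexI[of _ "a - x"]) simp_all
  next
    assume "\<exists>s\<in>\<Sigma>. x + s \<in> A"
    then obtain s where s: "s \<in> \<Sigma>" "x + s \<in> A" by blast
    have "y - x \<in> \<Sigma> \<longleftrightarrow> y - (x + s) \<in> \<Sigma>" for y
    proof
      assume "y - x \<in> \<Sigma>"
      with s(1) have "y - x + - s \<in> \<Sigma>" using subgroup_\<Sigma> unfolding add_subgroup_def by blast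
      then show "y - (x + s) \<in> \<Sigma>" by (simp only: diff_diff_eq add_uminus_conv_diff)
    next
      assume "y - (x + s) \<in> \<Sigma>"
      with s(1) have "y - (x + s) + s \<in> \<Sigma>" using subgroup_\<Sigma> unfolding add_subgroup_def by blast
      then show "y - x \<in> \<Sigma>" by (simp add: algebra_simps)
    qed
    then have "?c x = ?c (x + s)" by (auto simp: set_eq_iff mem_translate_iff)
    with s(2) show "?c x \<in> ?c ` A" by blast
  qed
  have op: "openin (coset_topology \<Sigma>) (?O n)" for n
  proof -
    have "open {x. x + s \<in> U \<times> ball 0 (real n)}" for s :: "'h \<times> (real ^ 'd)"
    proof -
      have "{x. x + s \<in> U \<times> ball 0 (real n)} =
          ((\<lambda>h. h + fst s) -` U) \<times> ((\<lambda>h. h + snd s) -` ball 0 (real n))"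
        by (auto simp: plus_prod_def)
      then show ?thesis
        by (simp only:) (intro open_Times open_vimage open_ball continuous_intros assms(1))
    qed
    then have "open (\<Union>s\<in>\<Sigma>. {x. x + s \<in> U \<times> ball 0 (real n)})" by blast
    moreover have "{x. ?c x \<in> ?O n} = (\<Union>s\<in>\<Sigma>. {x. x + s \<in> U \<times> ball 0 (real n)})"
      by (simp only: coset Collect_bex_eq)
    ultimately show ?thesis by (auto simp: openin_coset_topology)
  qed
  have top: "topspace (coset_topology \<Sigma>) = range ?c"
    using quotient_map_coset_topology[of \<Sigma>] by (simp add: quotient_map_def)
  have cover: "range ?c \<subseteq> \<Union>(range ?O)"
  proof clarify
    fix h :: 'h and x :: "real ^ 'd"
    have "open {s. h + s \<in> U}"
      using open_vimage[OF assms(1) continuous_on_add[OF continuous_on_const continuous_on_id]]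
      by (simp add: vimage_def)
    moreover from assms(2) obtain u where "u \<in> U" by blast
    then have "u - h \<in> {s. h + s \<in> U}" by simp
    ultimately obtain \<gamma> where \<gamma>: "\<gamma> \<in> \<Gamma>" "h + star \<Sigma> \<gamma> \<in> U"
      using star_dense by blast
    obtain n :: nat where "norm (x + \<gamma>) < n" using reals_Archimedean2 by blast
    with \<gamma> have "(h, x) + (star \<Sigma> \<gamma>, \<gamma>) \<in> U \<times> ball 0 (real n)" by simp
    with star_in[OF \<gamma>(1)] have "?c (h, x) \<in> ?O n" by (intro coset[THEN iffD2] bexI)
    then show "?c (h, x) \<in> \<Union>(range ?O)" by blast
  qed
  have "compactin (coset_topology \<Sigma>) (range ?c)"
    using cps by (simp add: cut_and_project_scheme_def cocompact_def compact_space_def top)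
  moreover have "openin (coset_topology \<Sigma>) A" if "A \<in> range ?O" for A
    using that op by auto
  ultimately obtain \<F> where \<F>: "finite \<F>" "\<F> \<subseteq> range ?O" "range ?c \<subseteq> \<Union>\<F>"
    using compactinD[OF _ _ cover] by metis
  then obtain I where I: "finite I" "range ?c \<subseteq> (\<Union>n\<in>I. ?O n)"
    using finite_subset_image[OF \<F>(1,2)] by blast
  \<comment> \<open>Inserting \<open>0\<close> keeps \<open>Max\<close> away from an empty
    set.\<close>
  define m where "m = Max (insert 0 I)"
  have m: "n \<le> m" if "n \<in> I" for n using I(1) that by (simp add: m_def)
  show ?thesis
  proof (rule that[of m])
    fix x :: "real ^ 'd"
    have "?c (0, x) \<in> (\<Union>n\<in>I. ?O n)" using I(2) by blast
    then obtain n where n: "n \<in> I" "?c (0, x) \<in> ?O n" by blast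
    then obtain s where s: "s \<in> \<Sigma>" "(0, x) + s \<in> U \<times> ball 0 (real n)"
      using coset[THEN iffD1, OF n(2)] by (elim bexE)
    then have "snd s \<in> \<Gamma>" "star \<Sigma> (snd s) = fst s"
      by (auto simp: Gam_def star_eqI)
    with s(2) m[OF n(1)] show "\<exists>\<gamma>\<in>proj_set \<Sigma> U. norm (x + \<gamma>) < m"
      by (intro bexI[of _ "snd s"]) (auto simp: proj_set_def plus_prod_def)
  qed
qed

lemma open_translate: "open U \<Longrightarrow> open ((+) w ` U)" for w :: 'h
proof -
  assume "open U"
  moreover have "(+) w ` U = (\<lambda>x. x - w) -` U" by (auto simp: mem_translate_iff)
  ultimately show ?thesis by (simp only:) (intro open_vimage continuous_intros)
qed

text \<open>Supplies points far from any given point; \<open>internal_iff\<close> uses them to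
  control the radius of a patch.\<close>

lemma model_set_unbounded: "\<exists>z\<in>proj_set \<Sigma> ((+) w ` W). norm (z - y) \<ge> R"
proof -
  obtain n where n: "\<And>x. \<exists>\<gamma>\<in>proj_set \<Sigma> ((+) w ` interior W). norm (x + \<gamma>) < n"
    using proj_set_relatively_dense[of "(+) w ` interior W"] interior_W_nonempty open_translate
    by (metis image_is_empty open_interior)
  \<comment> \<open>A point within \<open>n\<close> of \<open>y - x\<close> has distance at least
    \<open>norm x - n\<close> from \<open>y\<close>, which is at least \<open>R\<close> by the
    choice of \<open>norm x\<close>.\<close>
  obtain x :: "real ^ 'd" where x: "norm x = \<bar>R\<bar> + \<bar>n\<bar>"
    using vector_choose_size[of "\<bar>R\<bar> + \<bar>n\<bar>"] by auto
  obtain \<gamma> where \<gamma>: "\<gamma> \<in> proj_set \<Sigma> ((+) w ` interior W)" "norm (x - y + \<gamma>) < n"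
    using n by blast
  have "norm x \<le> norm (x - y + \<gamma>) + norm (\<gamma> - y)"
    using norm_triangle_ineq4[of "x - y + \<gamma>" "\<gamma> - y"] by simp
  with x \<gamma>(2) have "norm (\<gamma> - y) \<ge> R" by linarith
  moreover have "\<gamma> \<in> proj_set \<Sigma> ((+) w ` W)"
    using \<gamma>(1) interior_subset by (auto simp: proj_set_def)
  ultimately show ?thesis by blast
qed

section \<open>Sandwiched sets and uniqueness of the parameter\<close>

lemma model_set_translate:
  "\<delta> \<in> \<Gamma> \<Longrightarrow> y + \<delta> \<in> proj_set \<Sigma> ((+) (w + star \<Sigma> \<delta>) ` A) \<longleftrightarrow> y \<in> proj_set \<Sigma> ((+) w ` A)"
  by (auto simp: mem_model_set \<Gamma>_add_iff star_add)

text \<open>The relation whose unique solution \<open>w\<close> is \<open>internal_param\<close>,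
  usable before existence and uniqueness are known.\<close>

definition sandwiched :: "(real ^ 'd) set \<Rightarrow> 'h \<Rightarrow> bool" where
  "sandwiched \<Lambda> w \<longleftrightarrow> proj_set \<Sigma> ((+) w ` interior W) \<subseteq> \<Lambda> \<and> \<Lambda> \<subseteq> proj_set \<Sigma> ((+) w ` W)"

text \<open>For fixed \<open>\<Lambda>\<close> and \<open>\<gamma>\<close>, each clause is a closed
  condition on \<open>w\<close>; the compactness arguments below rest on this form.\<close>

lemma sandwiched_iff:
  "sandwiched \<Lambda> w \<longleftrightarrow> \<Lambda> \<subseteq> \<Gamma> \<and>
     (\<forall>\<gamma>\<in>\<Gamma>. (\<gamma> \<in> \<Lambda> \<longrightarrow> star \<Sigma> \<gamma> - w \<in> W) \<and> (\<gamma> \<notin> \<Lambda> \<longrightarrow> star \<Sigma> \<gamma> - w \<notin> interior W))"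
  unfolding sandwiched_def by (auto simp: subset_iff mem_model_set)

text \<open>If \<open>v + interior W\<close> left the closed set \<open>w + W\<close>, the open
  difference would contain some \<open>star \<Sigma> \<gamma>\<close>, with \<open>\<gamma>\<close>
  both in and outside \<open>\<Lambda>\<close>. Taking closures gives
  \<open>v + W \<subseteq> w + W\<close>; by symmetry the two agree, and irredundancy
  concludes.\<close>

lemma sandwiched_unique:
  assumes "sandwiched \<Lambda> v" "sandwiched \<Lambda> w" shows "v = w"
proof -
  have sub: "(+) v ` W \<subseteq> (+) w ` W" if "sandwiched \<Lambda> v" "sandwiched \<Lambda> w" for v w
  proof -
    let ?V = "(+) v ` interior W - (+) w ` W"
    have closed: "closed ((+) w ` W)"
      by (intro compact_imp_closed compact_continuous_image continuous_intros compact_W)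
    have "open ?V" using closed by (intro open_Diff open_translate) auto
    moreover have "star \<Sigma> \<gamma> \<notin> ?V" if "\<gamma> \<in> \<Gamma>" for \<gamma>
      using \<open>sandwiched \<Lambda> v\<close> \<open>sandwiched \<Lambda> w\<close> that by (auto simp: sandwiched_iff mem_translate_iff)
    ultimately have "?V = {}" using star_dense by blast
    then have "interior W \<subseteq> (\<lambda>x. v + x) -` ((+) w ` W)" by blast
    moreover have "closed ((\<lambda>x. v + x) -` ((+) w ` W))"
      by (intro closed_vimage closed continuous_intros)
    ultimately have "closure (interior W) \<subseteq> (\<lambda>x. v + x) -` ((+) w ` W)"
      by (rule closure_minimal)
    then show ?thesis using window by (auto simp: window_def)
  qed
  have eq: "(+) v ` W = (+) w ` W" using sub assms by blast
  have "(+) (v - w) ` W = (+) (- w) ` (+) v ` W" by (simp add: image_image algebra_simps)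
  also have "\<dots> = W" unfolding eq by (simp add: image_image)
  finally have "v - w = 0" using window unfolding window_def by blast
  then show ?thesis by simp
qed

lemma sandwiched_translate:
  assumes "\<gamma> \<in> \<Gamma>" "sandwiched \<Lambda> w"
  shows "sandwiched ((\<lambda>x. x + \<gamma>) ` \<Lambda>) (w + star \<Sigma> \<gamma>)"
proof -
  have "y \<in> (\<lambda>x. x + \<gamma>) ` \<Lambda> \<longleftrightarrow> y - \<gamma> \<in> \<Lambda>" for y by (force simp: image_iff)
  moreover have "y \<in> proj_set \<Sigma> ((+) (w + star \<Sigma> \<gamma>) ` A) \<longleftrightarrow> y - \<gamma> \<in> proj_set \<Sigma> ((+) w ` A)" for y A
    using model_set_translate[OF assms(1), of "y - \<gamma>"] by simp
  ultimately show ?thesis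
    using assms(2) unfolding sandwiched_def subset_iff by simp
qed

lemma sandwiched_model_set: "w \<in> NS \<Sigma> W \<Longrightarrow> sandwiched (proj_set \<Sigma> ((+) w ` W)) w"
  using interior_subset by (auto simp: sandwiched_def proj_set_def)

lemma sandwiched_nonempty: "sandwiched \<Lambda> w \<Longrightarrow> \<Lambda> \<noteq> {}"
proof -
  assume *: "sandwiched \<Lambda> w"
  obtain \<gamma> where "\<gamma> \<in> \<Gamma>" "star \<Sigma> \<gamma> \<in> (+) w ` interior W"
    using star_dense[of "(+) w ` interior W"] interior_W_nonempty open_translate by auto
  with * show ?thesis by (auto simp: sandwiched_iff mem_translate_iff)
qed

text \<open>For compact \<open>C\<close> the right-hand side is locally finite, and it is common to
  all sets with parameter in \<open>C\<close>.\<close>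

lemma sandwiched_subset:
  assumes "sandwiched \<Lambda> w" "w \<in> C"
  shows "\<Lambda> \<subseteq> proj_set \<Sigma> ((\<lambda>(x, y). x + y) ` (C \<times> W))"
proof
  fix \<gamma> assume "\<gamma> \<in> \<Lambda>"
  with assms(1) have "\<gamma> \<in> \<Gamma>" "star \<Sigma> \<gamma> - w \<in> W" by (auto simp: sandwiched_iff)
  with assms(2) show "\<gamma> \<in> proj_set \<Sigma> ((\<lambda>(x, y). x + y) ` (C \<times> W))"
    by (auto simp: proj_set_def intro!: rev_image_eqI[of "(w, star \<Sigma> \<gamma> - w)"])
qed

section \<open>Languages\<close>

text \<open>As \<open>v\<close> is nonsingular, each \<open>star \<Sigma> y - v\<close> lies in one
  of the open sets \<open>interior W\<close> and \<open>- W\<close>, hence stays there for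
  \<open>u\<close> near \<open>v\<close>. With \<open>u\<close> confined to a compact neighbourhood,
  only finitely many \<open>y\<close> in \<open>B\<close> can ever reach \<open>W\<close>, so
  finitely many open conditions suffice.\<close>

lemma model_set_locally_constant:
  assumes v: "v \<in> NS \<Sigma> W" and B: "bounded B"
  obtains U where "open U" "v \<in> U"
    "\<And>u y. \<lbrakk>u \<in> U; y \<in> \<Gamma> \<inter> B; star \<Sigma> y - v \<in> W\<rbrakk> \<Longrightarrow> star \<Sigma> y - u \<in> interior W"
    "\<And>u y. \<lbrakk>u \<in> U; y \<in> \<Gamma> \<inter> B; star \<Sigma> y - v \<notin> W\<rbrakk> \<Longrightarrow> star \<Sigma> y - u \<notin> W"
proof -
  obtain N K where N: "open N" "compact K" "v \<in> N" "N \<subseteq> K"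
    using locally_compact_H[unfolded locally_compact_space_def, THEN bspec, of v] by auto
  let ?S = "proj_set \<Sigma> ((\<lambda>(x, y). x + y) ` (K \<times> W))"
  let ?F = "?S \<inter> closure B"
  let ?U = "\<lambda>y. {u. star \<Sigma> y - u \<in> (if star \<Sigma> y - v \<in> W then interior W else - W)}"
  have F: "finite ?F"
    using B compact_set_plus[OF N(2) compact_W] by (intro finite_proj_set_Int) simp_all
  have far: "star \<Sigma> y - u \<notin> W" if "y \<in> \<Gamma>" "y \<notin> ?S" "u \<in> N" for u y
  proof
    assume "star \<Sigma> y - u \<in> W"
    with that(3) N(4) have "u + (star \<Sigma> y - u) \<in> (\<lambda>(x, y). x + y) ` (K \<times> W)" by blast
    with that show False by (simp add: proj_set_def)
  qed
  have U: "u \<in> ?U y" if "u \<in> N \<inter> (\<Inter>y\<in>?F. ?U y)" "y \<in> \<Gamma> \<inter> B" for u y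
  proof (cases "y \<in> ?S")
    case True
    then have "y \<in> ?F" using that(2) closure_subset by blast
    with that(1) show ?thesis by blast
  next
    case False
    with that far N(3) show ?thesis by auto
  qed
  show ?thesis
  proof (rule that[of "N \<inter> (\<Inter>y\<in>?F. ?U y)"])
    show "open (N \<inter> (\<Inter>y\<in>?F. ?U y))"
      using N(1) F closed_W by (intro open_Int open_INT ballI open_diff_left) auto
    have "v \<in> ?U y" if "y \<in> ?F" for y
      using NS_interior[OF v] that by (auto simp: proj_set_def)
    then show "v \<in> N \<inter> (\<Inter>y\<in>?F. ?U y)" using N(3) by blast
  next
    fix u y assume "u \<in> N \<inter> (\<Inter>y\<in>?F. ?U y)" "y \<in> \<Gamma> \<inter> B" "star \<Sigma> y - v \<in> W"
    then show "star \<Sigma> y - u \<in> interior W" using U[of u y] by simp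
  next
    fix u y assume "u \<in> N \<inter> (\<Inter>y\<in>?F. ?U y)" "y \<in> \<Gamma> \<inter> B" "star \<Sigma> y - v \<notin> W"
    then show "star \<Sigma> y - u \<notin> W" using U[of u y] by simp
  qed
qed

text \<open>By density some \<open>\<gamma>\<close> brings \<open>w - star \<Sigma> \<gamma>\<close>
  into the neighbourhood \<open>U\<close> of \<open>v\<close>. There the points of
  \<open>\<Gamma>\<close> in \<open>ball 0 R\<close> avoid the frontier of the window, so the
  sandwich decides membership and \<open>\<Lambda>\<close> shifted by \<open>- \<gamma>\<close>
  agrees with the model set of \<open>v\<close> on that ball.\<close>

lemma language_subset_sandwiched:
  assumes v: "v \<in> NS \<Sigma> W" and \<Lambda>: "sandwiched \<Lambda> w"
  shows "language (proj_set \<Sigma> ((+) v ` W)) \<subseteq> language \<Lambda>"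
proof (rule language_subsetI)
  fix R :: real
  obtain U where U: "open U" "v \<in> U"
    "\<And>u y. \<lbrakk>u \<in> U; y \<in> \<Gamma> \<inter> ball 0 R; star \<Sigma> y - v \<in> W\<rbrakk> \<Longrightarrow> star \<Sigma> y - u \<in> interior W"
    "\<And>u y. \<lbrakk>u \<in> U; y \<in> \<Gamma> \<inter> ball 0 R; star \<Sigma> y - v \<notin> W\<rbrakk> \<Longrightarrow> star \<Sigma> y - u \<notin> W"
    using model_set_locally_constant[OF v bounded_ball] by metis
  have "w - v \<in> {s. w - s \<in> U}" using U(2) by simp
  then obtain \<gamma> where \<gamma>: "\<gamma> \<in> \<Gamma>" "w - star \<Sigma> \<gamma> \<in> U"
    using star_dense[OF open_diff_left[OF U(1)], of w] by blast
  have "y \<in> proj_set \<Sigma> ((+) v ` W) \<longleftrightarrow> y + \<gamma> \<in> \<Lambda>" if "y \<in> ball 0 R" for y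
  proof (cases "y \<in> \<Gamma>")
    case True
    have eq: "star \<Sigma> y - (w - star \<Sigma> \<gamma>) = star \<Sigma> (y + \<gamma>) - w"
      using star_add[OF True \<gamma>(1)] by simp
    show ?thesis
      using U(3,4)[OF \<gamma>(2), of y, unfolded eq] True that \<Lambda> \<Gamma>_add[OF True \<gamma>(1)]
      unfolding mem_model_set sandwiched_iff by blast
  next
    case False
    then show ?thesis
      using \<Lambda> \<Gamma>_add_iff[OF \<gamma>(1), of y] unfolding mem_model_set sandwiched_iff by blast
  qed
  then show "\<exists>t. \<forall>y\<in>ball 0 R. y \<in> proj_set \<Sigma> ((+) v ` W) \<longleftrightarrow> y + t \<in> \<Lambda>" by blast
qed

text \<open>Two nonsingular model sets have the same language by
  \<open>language_subset_sandwiched\<close> in both directions, so the definite description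
  denotes.\<close>

lemma language_NS_eq:
  assumes "w \<in> NS \<Sigma> W" shows "language_NS \<Sigma> W = language (proj_set \<Sigma> ((+) w ` W))"
  unfolding language_NS_def
proof (rule the_equality)
  have tr: "language ((\<lambda>y. y - t) ` A) = language A" for A :: "(real ^ 'd) set" and t
    using language_translate[of "- t" A] by simp
  show "\<forall>v\<in>NS \<Sigma> W. \<forall>t. language ((\<lambda>y. y - t) ` proj_set \<Sigma> ((+) v ` W)) =
      language (proj_set \<Sigma> ((+) w ` W))"
    unfolding tr using language_subset_sandwiched sandwiched_model_set assms by blast
  fix L assume "\<forall>v\<in>NS \<Sigma> W. \<forall>t. language ((\<lambda>y. y - t) ` proj_set \<Sigma> ((+) v ` W)) = L"
  then show "L = language (proj_set \<Sigma> ((+) w ` W))"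
    unfolding tr using assms by blast
qed

section \<open>Membership in the internal system by finite approximation\<close>

text \<open>Membership in the closure of the nonsingular model sets under pointwise convergence of
  indicator functions. Unlike equality of languages, this is visibly a closed condition.\<close>

definition NS_approximable :: "(real ^ 'd) set \<Rightarrow> bool" where
  "NS_approximable \<Lambda> \<longleftrightarrow>
     (\<forall>F. finite F \<longrightarrow> (\<exists>w\<in>NS \<Sigma> W. \<forall>y\<in>F. y \<in> \<Lambda> \<longleftrightarrow> y \<in> proj_set \<Sigma> ((+) w ` W)))"

text \<open>The conditions of \<open>sandwiched_iff\<close> on \<open>w\<close> are closed, the one
  at \<open>x\<close> confines \<open>w\<close> to a compact set, and finitely many of them are met
  by an approximating nonsingular parameter. The finite intersection property gives
  \<open>w\<close>.\<close>

lemma NS_approximable_sandwiched: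
  assumes \<Lambda>: "NS_approximable \<Lambda>" "\<Lambda> \<subseteq> \<Gamma>" "\<Lambda> \<noteq> {}"
  shows "\<exists>w. sandwiched \<Lambda> w"
proof -
  obtain x where x: "x \<in> \<Lambda>" using \<Lambda>(3) by blast
  let ?A = "\<lambda>\<gamma>. {w. star \<Sigma> \<gamma> - w \<in> (if \<gamma> \<in> \<Lambda> then W else - interior W)}"
  have "{w. star \<Sigma> x - w \<in> W} \<inter> (\<Inter>\<gamma>\<in>\<Gamma>. ?A \<gamma>) \<noteq> {}"
  proof (rule compact_imp_fip_image)
    show "compact {w. star \<Sigma> x - w \<in> W}" using compact_W by (rule compact_diff_left)
    show "closed (?A \<gamma>)" for \<gamma> using closed_W by (intro closed_diff_left) auto
    fix F assume F: "finite F" "F \<subseteq> \<Gamma>"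
    obtain w where w: "w \<in> NS \<Sigma> W" "\<forall>y\<in>insert x F. y \<in> \<Lambda> \<longleftrightarrow> y \<in> proj_set \<Sigma> ((+) w ` W)"
      using \<Lambda>(1) F(1) unfolding NS_approximable_def by (metis finite_insert)
    have "w \<in> ?A y" if "y \<in> F" for y
      using w that F(2) interior_subset[of W] by (auto simp: mem_model_set)
    moreover have "star \<Sigma> x - w \<in> W" using w x by (auto simp: mem_model_set)
    ultimately show "{w. star \<Sigma> x - w \<in> W} \<inter> (\<Inter>\<gamma>\<in>F. ?A \<gamma>) \<noteq> {}" by blast
  qed
  then obtain w where "\<forall>\<gamma>\<in>\<Gamma>. w \<in> ?A \<gamma>" by blast
  then have "sandwiched \<Lambda> w" using \<Lambda>(2) by (auto simp: sandwiched_iff)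
  then show ?thesis by blast
qed

text \<open>Forwards, a large patch of \<open>\<Lambda>\<close> around \<open>x\<close> occurs in
  \<open>?P\<close>, and a translate of \<open>?P\<close> by an element of \<open>\<Gamma>\<close>
  is again a nonsingular model set. Backwards, local finiteness turns approximation at finitely many
  points into agreement on a ball; the other inclusion of languages is
  \<open>language_subset_sandwiched\<close>.\<close>

lemma internal_iff:
  "\<Lambda> \<in> internal \<Sigma> W \<longleftrightarrow> \<Lambda> \<subseteq> \<Gamma> \<and> \<Lambda> \<noteq> {} \<and> NS_approximable \<Lambda>"
proof (intro iffI conjI)
  obtain v where v: "v \<in> NS \<Sigma> W" using NS_nonempty by blast
  let ?P = "proj_set \<Sigma> ((+) v ` W)"
  {
    assume "\<Lambda> \<in> internal \<Sigma> W"
    then have L: "language \<Lambda> = language ?P" and sub: "\<Lambda> \<subseteq> \<Gamma>"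
      by (simp_all add: internal_def cps_hull_def language_NS_eq[OF v])
    show "\<Lambda> \<subseteq> \<Gamma>" by fact
    show ne: "\<Lambda> \<noteq> {}"
      using L sandwiched_nonempty[OF sandwiched_model_set[OF v]] by (metis language_eq_empty_iff)
    then obtain x where x: "x \<in> \<Lambda>" by blast
    show "NS_approximable \<Lambda>"
      unfolding NS_approximable_def
    proof (intro allI impI)
      fix F :: "(real ^ 'd) set" assume "finite F"
      then obtain R where R: "R > 0" "\<And>y. y \<in> F \<Longrightarrow> norm (y - x) < R"
        using finite_imp_bounded[of "(\<lambda>y. y - x) ` F"] unfolding bounded_pos_less by auto
      text \<open>A patch does not record its radius. A point of \<open>\<Lambda>\<close> at distance at least \<open>R\<close> from \<open>x\<close>
        forces the patch of \<open>?P\<close> that matches \<open>\<Lambda>\<close> at \<open>x\<close> to have radius at least \<open>R\<close>.\<close>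
      obtain z where z: "z \<in> \<Lambda>" "norm (z - x) \<ge> R"
      proof -
        \<comment> \<open>Two points of \<open>?P\<close> at distance at least \<open>2 * R\<close>
          are copied into \<open>\<Lambda>\<close>; by the triangle inequality one of the copies is
          at distance at least \<open>R\<close> from \<open>x\<close>.\<close>
        obtain a where a: "a \<in> ?P" using model_set_unbounded by blast
        obtain b where b: "b \<in> ?P" "norm (b - a) \<ge> 2 * R" using model_set_unbounded by blast
        let ?r = "norm (b - a) + 1"
        have "?r > 0" by (smt (verit) norm_ge_zero)
        then have "{u \<in> ball 0 ?r. a + u \<in> ?P} \<in> language \<Lambda>"
          unfolding L language_altdef[of ?P] using a by blast
        then obtain c r where c: "c \<in> \<Lambda>" "{u \<in> ball 0 ?r. a + u \<in> ?P} = {u \<in> ball 0 r. c + u \<in> \<Lambda>}"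
          unfolding language_altdef[of \<Lambda>] by blast
        have "b - a \<in> {u \<in> ball 0 ?r. a + u \<in> ?P}" using b by simp
        then have "c + (b - a) \<in> \<Lambda>" unfolding c(2) by blast
        moreover have "norm (b - a) \<le> norm (c + (b - a) - x) + norm (c - x)"
          using norm_triangle_ineq4[of "c + (b - a) - x" "c - x"] by (simp add: algebra_simps)
        ultimately show ?thesis using that[of c] that[of "c + (b - a)"] c(1) b(2) by linarith
      qed
      \<comment> \<open>The \<open>+ 1\<close> puts \<open>z - x\<close> strictly inside the open
        ball, hence into the patch.\<close>
      let ?r = "norm (z - x) + 1"
      have "?r > 0" by (smt (verit) norm_ge_zero)
      then have "{u \<in> ball 0 ?r. x + u \<in> \<Lambda>} \<in> language ?P"
        unfolding L[symmetric] language_altdef[of \<Lambda>] using x by blast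
      then obtain a r where a: "a \<in> ?P" "{u \<in> ball 0 ?r. x + u \<in> \<Lambda>} = {u \<in> ball 0 r. a + u \<in> ?P}"
        unfolding language_altdef[of ?P] by blast
      have "z - x \<in> {u \<in> ball 0 ?r. x + u \<in> \<Lambda>}" using z by simp
      then have r: "norm (z - x) < r" unfolding a(2) by simp
      \<comment> \<open>This translation carries the matching point \<open>a\<close> of
        \<open>?P\<close> to \<open>x\<close>, and \<open>NS_translate\<close> keeps the shifted
        parameter nonsingular.\<close>
      have d: "x - a \<in> \<Gamma>"
        using a(1) x sub \<Gamma>_add[OF _ \<Gamma>_minus, of x a] by (auto simp: mem_model_set)
      have "y \<in> \<Lambda> \<longleftrightarrow> y \<in> proj_set \<Sigma> ((+) (v + star \<Sigma> (x - a)) ` W)" if "y \<in> F" for y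
      proof -
        have "norm (y - x) < r" "norm (y - x) < ?r" using R(2)[OF that] z(2) r by linarith+
        then have "y - x \<in> {u \<in> ball 0 ?r. x + u \<in> \<Lambda>} \<longleftrightarrow> y \<in> \<Lambda>"
          "y - x \<in> {u \<in> ball 0 r. a + u \<in> ?P} \<longleftrightarrow> y - (x - a) \<in> ?P"
          by (simp_all add: algebra_simps)
        then have "y \<in> \<Lambda> \<longleftrightarrow> y - (x - a) \<in> ?P" unfolding a(2) by blast
        then show ?thesis using model_set_translate[OF d, of "y - (x - a)" v W] by simp
      qed
      then show "\<exists>w\<in>NS \<Sigma> W. \<forall>y\<in>F. y \<in> \<Lambda> \<longleftrightarrow> y \<in> proj_set \<Sigma> ((+) w ` W)"
        using NS_translate[OF v d] by blast
    qed
  }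
  assume A: "\<Lambda> \<subseteq> \<Gamma> \<and> \<Lambda> \<noteq> {} \<and> NS_approximable \<Lambda>"
  then obtain w where w: "sandwiched \<Lambda> w" using NS_approximable_sandwiched by blast
  have "language \<Lambda> \<subseteq> language ?P"
  proof -
    obtain x where x: "x \<in> \<Lambda>" using A by blast
    \<comment> \<open>A sandwiched set containing \<open>x\<close> has its parameter in the compact
      set \<open>{w. star \<Sigma> x - w \<in> W}\<close>, so it lies in the locally finite set
      \<open>?S\<close>.\<close>
    let ?S = "proj_set \<Sigma> ((\<lambda>(x, y). x + y) ` ({w. star \<Sigma> x - w \<in> W} \<times> W))"
    have inS: "M \<subseteq> ?S" if "sandwiched M u" "x \<in> M" for M u
      using that by (intro sandwiched_subset[of _ u]) (auto simp: sandwiched_iff)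
    have "{z \<in> ball 0 R. y + z \<in> \<Lambda>} \<in> language ?P" if "y \<in> \<Lambda>" "R > 0" for y R
    proof -
      have "finite (?S \<inter> cball y R)"
        by (intro finite_proj_set_Int compact_set_plus compact_diff_left compact_W compact_cball)
      \<comment> \<open>Testing at \<open>x\<close> as well forces the model set of \<open>u\<close>
        into \<open>?S\<close>, so agreement on the finite set extends to all of
        \<open>cball y R\<close>.\<close>
      then obtain u where u: "u \<in> NS \<Sigma> W"
          "\<forall>q\<in>insert x (?S \<inter> cball y R). q \<in> \<Lambda> \<longleftrightarrow> q \<in> proj_set \<Sigma> ((+) u ` W)"
        using A unfolding NS_approximable_def by (metis finite_insert)
      let ?Q = "proj_set \<Sigma> ((+) u ` W)"
      have Q: "?Q \<subseteq> ?S" using inS[OF sandwiched_model_set[OF u(1)]] u(2) x by blast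
      have eq: "q \<in> \<Lambda> \<longleftrightarrow> q \<in> ?Q" if "q \<in> cball y R" for q
        using u(2) Q inS[OF w x] that by blast
      have "y + z \<in> \<Lambda> \<longleftrightarrow> y + z \<in> ?Q" if "z \<in> ball 0 R" for z
        using that by (intro eq) (simp add: dist_norm)
      then have "{z \<in> ball 0 R. y + z \<in> \<Lambda>} = {z \<in> ball 0 R. y + z \<in> ?Q}" by blast
      moreover have "y \<in> ?Q" using eq[of y] that by simp
      ultimately have "{z \<in> ball 0 R. y + z \<in> \<Lambda>} \<in> language ?Q"
        unfolding language_altdef[of ?Q] using \<open>R > 0\<close> by blast
      then show ?thesis using language_NS_eq[OF u(1)] language_NS_eq[OF v] by simp
    qed
    then show ?thesis by (auto simp: language_altdef[of \<Lambda>])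
  qed
  with language_subset_sandwiched[OF v w] A show "\<Lambda> \<in> internal \<Sigma> W"
    by (auto simp: internal_def cps_hull_def language_NS_eq[OF v])
qed

section \<open>The parametrization of the internal system\<close>

lemma internal_param_eqI: "sandwiched \<Lambda> w \<Longrightarrow> internal_param \<Sigma> W \<Lambda> = w"
  unfolding internal_param_def
  by (intro the_equality) (auto simp flip: sandwiched_def intro: sandwiched_unique)

lemma sandwiched_internal_param: "\<Lambda> \<in> internal \<Sigma> W \<Longrightarrow> sandwiched \<Lambda> (internal_param \<Sigma> W \<Lambda>)"
  using NS_approximable_sandwiched internal_param_eqI by (metis internal_iff)

lemma internal_nonempty: "internal \<Sigma> W \<noteq> {}"
proof -
  obtain w where w: "w \<in> NS \<Sigma> W" using NS_nonempty by blast
  have "proj_set \<Sigma> ((+) w ` W) \<in> internal \<Sigma> W"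
    unfolding internal_def cps_hull_def language_NS_eq[OF w] by (auto simp: mem_model_set)
  then show ?thesis by blast
qed

text \<open>By uniqueness, no parameter in the compact set \<open>D\<close> outside \<open>U\<close>
  meets all closed conditions imposed by \<open>\<Lambda>\<close>, so finitely many of them, indexed
  by \<open>F\<close>, already exclude \<open>D\<close>. Agreement at \<open>x\<close> keeps the
  parameter of \<open>\<Lambda>'\<close> in the compact set; agreement on \<open>F\<close> then
  forces it into \<open>U\<close>.\<close>

lemma continuous_map_internal_param:
  "continuous_map (internal_topology \<Sigma> W) euclidean (internal_param \<Sigma> W)"
proof -
  have "\<exists>K. compact K \<and>
      {\<Lambda>' \<in> internal \<Sigma> W. \<Lambda> \<inter> K = \<Lambda>' \<inter> K} \<subseteq> {\<Lambda> \<in> internal \<Sigma> W. internal_param \<Sigma> W \<Lambda> \<in> U}"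
    if U: "open U" and \<Lambda>: "\<Lambda> \<in> internal \<Sigma> W" "internal_param \<Sigma> W \<Lambda> \<in> U" for U \<Lambda>
  proof -
    obtain x where x: "x \<in> \<Lambda>" "x \<in> \<Gamma>" using \<Lambda>(1) by (auto simp: internal_iff)
    define A where "A \<gamma> = {w. star \<Sigma> \<gamma> - w \<in> (if \<gamma> \<in> \<Lambda> then W else - interior W)}" for \<gamma>
    define D where "D = {w. star \<Sigma> x - w \<in> W} - U"
    have "compact D"
      unfolding D_def using compact_diff_left[OF compact_W] U by (rule compact_diff)
    moreover have "closed (A \<gamma>)" for \<gamma> unfolding A_def using closed_W by (intro closed_diff_left) auto
    moreover have "D \<inter> (\<Inter>\<gamma>\<in>\<Gamma>. A \<gamma>) = {}"
    proof -
      have "w \<in> U" if "\<forall>\<gamma>\<in>\<Gamma>. w \<in> A \<gamma>" for w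
      proof -
        have "sandwiched \<Lambda> w" using that \<Lambda>(1) by (auto simp: A_def sandwiched_iff internal_iff)
        then show ?thesis using \<Lambda>(2) internal_param_eqI by blast
      qed
      then show ?thesis unfolding D_def by blast
    qed
    ultimately obtain F where F: "finite F" "F \<subseteq> \<Gamma>" "D \<inter> (\<Inter>\<gamma>\<in>F. A \<gamma>) = {}"
      using compact_imp_fip_image[of D \<Gamma> A] by meson
    have "internal_param \<Sigma> W \<Lambda>' \<in> U"
      if \<Lambda>': "\<Lambda>' \<in> internal \<Sigma> W" "\<Lambda> \<inter> insert x F = \<Lambda>' \<inter> insert x F" for \<Lambda>'
    proof -
      let ?w = "internal_param \<Sigma> W \<Lambda>'"
      have w: "sandwiched \<Lambda>' ?w" using \<Lambda>'(1) by (rule sandwiched_internal_param)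
      have eq: "\<gamma> \<in> \<Lambda>' \<longleftrightarrow> \<gamma> \<in> \<Lambda>" if "\<gamma> \<in> insert x F" for \<gamma> using \<Lambda>'(2) that by blast
      have "star \<Sigma> x - ?w \<in> W" using w x eq[of x] by (auto simp: sandwiched_iff)
      moreover have "?w \<in> A \<gamma>" if "\<gamma> \<in> F" for \<gamma>
        using w that F(2) eq[of \<gamma>] by (auto simp: A_def sandwiched_iff)
      ultimately show ?thesis using F(3) unfolding D_def by blast
    qed
    then show ?thesis using F(1) by (intro exI[of _ "insert x F"]) (auto intro: finite_imp_compact)
  qed
  then show ?thesis
    by (auto simp: continuous_map_def openin_internal_topology)
qed

text \<open>A set \<open>\<Lambda>\<close> is encoded by its indicator function, so that pairs of a set and a parameter in a
  compact set \<open>C\<close> live in a compact product space, where being sandwiched is a closed condition.\<close>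

lemma compactin_internal_param_vimage:
  assumes C: "compact C"
  shows "compactin (internal_topology \<Sigma> W) {\<Lambda> \<in> internal \<Sigma> W. internal_param \<Sigma> W \<Lambda> \<in> C}"
proof -
  define Z :: "((real ^ 'd \<Rightarrow> bool) \<times> 'h) set" where
    "Z = (UNIV \<times> C) \<inter> {p. NS_approximable (Collect (fst p))} \<inter> {p. sandwiched (Collect (fst p)) (snd p)}"
  have coord: "continuous_on UNIV (\<lambda>p::(real ^ 'd \<Rightarrow> bool) \<times> 'h. fst p y)" for y
    by (rule continuous_on_compose2[OF continuous_on_product_coordinates]) (auto intro: continuous_intros)
  \<comment> \<open>Since \<open>bool\<close> is discrete, every condition on a single coordinate is
    both open and closed.\<close>
  have op: "open {p::(real ^ 'd \<Rightarrow> bool) \<times> 'h. fst p y \<in> B}" for y B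
    using open_vimage[OF open_discrete coord] by (simp add: vimage_def)
  have cl: "closed {p::(real ^ 'd \<Rightarrow> bool) \<times> 'h. fst p y \<in> B}" for y B
    using closed_vimage[OF _ coord, of B] by (simp add: vimage_def closed_def open_discrete)
  have "closed {p::(real ^ 'd \<Rightarrow> bool) \<times> 'h. NS_approximable (Collect (fst p))}"
  proof -
    have "closed {p::(real ^ 'd \<Rightarrow> bool) \<times> 'h.
        \<exists>w\<in>NS \<Sigma> W. \<forall>y\<in>F. y \<in> Collect (fst p) \<longleftrightarrow> y \<in> proj_set \<Sigma> ((+) w ` W)}" if "finite F" for F
    proof -
      \<comment> \<open>Only the traces on \<open>F\<close> of the nonsingular model sets matter.
        There are finitely many, which turns the existential over \<open>NS \<Sigma> W\<close> into
        a finite union of closed sets.\<close>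
      let ?\<A> = "(\<lambda>w. F \<inter> proj_set \<Sigma> ((+) w ` W)) ` NS \<Sigma> W"
      have "finite ?\<A>" by (rule finite_subset[of _ "Pow F"]) (use that in auto)
      \<comment> \<open>\<open>{y \<in> A}\<close> is the one-element set holding a truth value,
        which puts the equivalence into the form of \<open>cl\<close>.\<close>
      moreover have "closed {p::(real ^ 'd \<Rightarrow> bool) \<times> 'h. \<forall>y\<in>F. fst p y \<in> {y \<in> A}}" for A
        unfolding Ball_def by (intro closed_Collect_all closed_Collect_imp open_Collect_const cl)
      ultimately have "closed (\<Union>A\<in>?\<A>. {p::(real ^ 'd \<Rightarrow> bool) \<times> 'h. \<forall>y\<in>F. fst p y \<in> {y \<in> A}})"
        by blast
      also have "(\<Union>A\<in>?\<A>. {p::(real ^ 'd \<Rightarrow> bool) \<times> 'h. \<forall>y\<in>F. fst p y \<in> {y \<in> A}}) =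
        {p. \<exists>w\<in>NS \<Sigma> W. \<forall>y\<in>F. y \<in> Collect (fst p) \<longleftrightarrow> y \<in> proj_set \<Sigma> ((+) w ` W)}"
        by auto
      finally show ?thesis .
    qed
    then have "closed {p::(real ^ 'd \<Rightarrow> bool) \<times> 'h. finite F \<longrightarrow>
        (\<exists>w\<in>NS \<Sigma> W. \<forall>y\<in>F. y \<in> Collect (fst p) \<longleftrightarrow> y \<in> proj_set \<Sigma> ((+) w ` W))}" for F
      by (cases "finite F") simp_all
    then show ?thesis
      unfolding NS_approximable_def by (intro closed_Collect_all)
  qed
  moreover have "closed {p::(real ^ 'd \<Rightarrow> bool) \<times> 'h. sandwiched (Collect (fst p)) (snd p)}"
  proof -
    have w: "closed {p::(real ^ 'd \<Rightarrow> bool) \<times> 'h. star \<Sigma> y - snd p \<in> A}" if "closed A" for y A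
    proof -
      have "closed ((\<lambda>p::(real ^ 'd \<Rightarrow> bool) \<times> 'h. star \<Sigma> y - snd p) -` A)"
        by (intro closed_vimage that continuous_intros)
      then show ?thesis by (simp add: vimage_def)
    qed
    have "closed {p::(real ^ 'd \<Rightarrow> bool) \<times> 'h. \<forall>y. fst p y \<in> {False} \<or> y \<in> \<Gamma>}"
      by (intro closed_Collect_all closed_Collect_disj closed_Collect_const cl)
    moreover have "closed {p::(real ^ 'd \<Rightarrow> bool) \<times> 'h. \<forall>y. y \<in> \<Gamma> \<longrightarrow>
        (fst p y \<in> {False} \<or> star \<Sigma> y - snd p \<in> W) \<and>
        (fst p y \<in> {True} \<or> star \<Sigma> y - snd p \<in> - interior W)}"
      by (intro closed_Collect_all closed_Collect_imp closed_Collect_conj closed_Collect_disj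
          open_Collect_const cl w closed_W closed_Compl open_interior)
    moreover have "{p. sandwiched (Collect (fst p)) (snd p)} =
        {p. \<forall>y. fst p y \<in> {False} \<or> y \<in> \<Gamma>} \<inter> {p. \<forall>y. y \<in> \<Gamma> \<longrightarrow>
        (fst p y \<in> {False} \<or> star \<Sigma> y - snd p \<in> W) \<and>
        (fst p y \<in> {True} \<or> star \<Sigma> y - snd p \<in> - interior W)}"
      by (auto simp: sandwiched_iff)
    ultimately show ?thesis by (simp only:) (rule closed_Int)
  qed
  moreover have "compact (UNIV :: (real ^ 'd \<Rightarrow> bool) set)"
  proof -
    have "compactin (product_topology (\<lambda>_::real ^ 'd. euclidean :: bool topology) UNIV)
        (PiE UNIV (\<lambda>_. UNIV))"
      by (subst compactin_PiE) (simp add: finite_imp_compact)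
    then show ?thesis by (simp add: euclidean_product_topology)
  qed
  ultimately have "compact Z"
    unfolding Z_def by (intro compact_Int_closed compact_Times C)
  \<comment> \<open>\<open>Z\<close> is the graph of \<open>internal_param\<close> over the preimage
    of \<open>C\<close>, in the indicator encoding.\<close>
  moreover have Z: "p \<in> Z \<longleftrightarrow> Collect (fst p) \<in> internal \<Sigma> W \<and> internal_param \<Sigma> W (Collect (fst p)) = snd p
      \<and> snd p \<in> C" for p
  proof
    assume p: "p \<in> Z"
    then have s: "sandwiched (Collect (fst p)) (snd p)" by (simp add: Z_def)
    then have "Collect (fst p) \<subseteq> \<Gamma>" "Collect (fst p) \<noteq> {}"
      using sandwiched_nonempty[OF s] by (simp_all add: sandwiched_iff)
    then show "Collect (fst p) \<in> internal \<Sigma> W \<and> internal_param \<Sigma> W (Collect (fst p)) = snd p \<and> snd p \<in> C"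
      using p internal_param_eqI[OF s] unfolding internal_iff Z_def by auto
  next
    assume p: "Collect (fst p) \<in> internal \<Sigma> W \<and> internal_param \<Sigma> W (Collect (fst p)) = snd p \<and> snd p \<in> C"
    then have "sandwiched (Collect (fst p)) (snd p)" using sandwiched_internal_param by metis
    with p show "p \<in> Z" unfolding internal_iff Z_def by (cases p) auto
  qed
  have "continuous_map (top_of_set Z) (internal_topology \<Sigma> W) (\<lambda>p. Collect (fst p))"
    unfolding continuous_map_def
  proof (intro conjI allI impI)
    show "(\<lambda>p. Collect (fst p)) \<in> topspace (top_of_set Z) \<rightarrow> topspace (internal_topology \<Sigma> W)"
      using Z by auto
    fix U assume U: "openin (internal_topology \<Sigma> W) U"
    show "openin (top_of_set Z) {p \<in> topspace (top_of_set Z). Collect (fst p) \<in> U}"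
    proof (subst openin_subopen, clarify)
      fix f w assume p: "(f, w) \<in> topspace (top_of_set Z)" "Collect (fst (f, w)) \<in> U"
      then obtain K where K: "compact K"
          "{\<Lambda>' \<in> internal \<Sigma> W. Collect f \<inter> K = \<Lambda>' \<inter> K} \<subseteq> U"
        using U unfolding openin_internal_topology by auto
      \<comment> \<open>All sets decoded from \<open>Z\<close> lie in one locally finite set, so
        agreement on \<open>K\<close> is a condition on finitely many coordinates, hence
        open.\<close>
      let ?F = "proj_set \<Sigma> ((\<lambda>(x, y). x + y) ` (C \<times> W)) \<inter> K"
      let ?N = "{q::(real ^ 'd \<Rightarrow> bool) \<times> 'h. \<forall>y\<in>?F. fst q y \<in> {f y}}"
      have "finite ?F" using compact_set_plus[OF C compact_W] K(1) by (rule finite_proj_set_Int)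
      then have "open (\<Inter>y\<in>?F. {q::(real ^ 'd \<Rightarrow> bool) \<times> 'h. fst q y \<in> {f y}})"
        using op by blast
      also have "(\<Inter>y\<in>?F. {q::(real ^ 'd \<Rightarrow> bool) \<times> 'h. fst q y \<in> {f y}}) = ?N" by auto
      finally have "open ?N" .
      then have "openin (top_of_set Z) (Z \<inter> ?N)" by (rule openin_open_Int)
      moreover have "Collect (fst q) \<in> U" if q: "q \<in> Z \<inter> ?N" for q
      proof -
        have sub: "Collect (fst r) \<subseteq> proj_set \<Sigma> ((\<lambda>(x, y). x + y) ` (C \<times> W))" if "r \<in> Z" for r
          using that sandwiched_subset unfolding Z_def by (cases r) auto
        have "Collect f \<inter> K = Collect (fst q) \<inter> K"
          using sub[of "(f, w)"] sub[of q] p(1) q by auto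
        then show ?thesis using K(2) q Z[of q] by blast
      qed
      ultimately show "\<exists>T. openin (top_of_set Z) T \<and> (f, w) \<in> T \<and>
          T \<subseteq> {p \<in> topspace (top_of_set Z). Collect (fst p) \<in> U}"
        using p(1) by (intro exI[of _ "Z \<inter> ?N"]) auto
    qed
  qed
  ultimately have "compactin (internal_topology \<Sigma> W) ((\<lambda>p. Collect (fst p)) ` Z)"
    by (intro image_compactin) (auto simp: compactin_subtopology)
  also have "(\<lambda>p. Collect (fst p)) ` Z = {\<Lambda> \<in> internal \<Sigma> W. internal_param \<Sigma> W \<Lambda> \<in> C}"
  proof (intro equalityI subsetI)
    fix \<Lambda> assume \<Lambda>: "\<Lambda> \<in> {\<Lambda> \<in> internal \<Sigma> W. internal_param \<Sigma> W \<Lambda> \<in> C}"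
    then have "((\<lambda>y. y \<in> \<Lambda>), internal_param \<Sigma> W \<Lambda>) \<in> Z" by (simp add: Z)
    then show "\<Lambda> \<in> (\<lambda>p. Collect (fst p)) ` Z" by (rule rev_image_eqI) simp
  qed (auto simp: Z)
  finally show ?thesis .
qed

section \<open>The Ellis semigroup\<close>

lemma ellis_subset: "ellis \<Sigma> W \<subseteq> (\<Pi>\<^sub>E \<Lambda>\<in>internal \<Sigma> W. internal \<Sigma> W)"
  using closure_of_subset_topspace[of "pointwise_topology \<Sigma> W"] by (simp add: ellis_def)

lemma ellis_apply: "g \<in> ellis \<Sigma> W \<Longrightarrow> \<Lambda> \<in> internal \<Sigma> W \<Longrightarrow> g \<Lambda> \<in> internal \<Sigma> W"
  using PiE_mem[OF subsetD[OF ellis_subset]] .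

lemma Gam_act_in_ellis: "\<gamma> \<in> \<Gamma> \<Longrightarrow> Gam_act \<Sigma> W \<gamma> \<in> ellis \<Sigma> W"
proof -
  have "Gam_act \<Sigma> W ` \<Gamma> \<subseteq> topspace (pointwise_topology \<Sigma> W)"
    using translate_internal[OF cps] by (auto simp: Gam_act_def)
  then show "\<gamma> \<in> \<Gamma> \<Longrightarrow> Gam_act \<Sigma> W \<gamma> \<in> ellis \<Sigma> W"
    unfolding ellis_def using closure_of_subset by blast
qed

lemma internal_param_Gam_act:
  assumes "\<gamma> \<in> \<Gamma>" "\<Lambda> \<in> internal \<Sigma> W"
  shows "internal_param \<Sigma> W (Gam_act \<Sigma> W \<gamma> \<Lambda>) = internal_param \<Sigma> W \<Lambda> + star \<Sigma> \<gamma>"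
  using internal_param_eqI[OF sandwiched_translate[OF assms(1) sandwiched_internal_param[OF assms(2)]]]
  by (simp add: Gam_act_def assms(2))

lemma continuous_map_internal_param_apply:
  assumes "\<Lambda> \<in> internal \<Sigma> W"
  shows "continuous_map (pointwise_topology \<Sigma> W) euclidean (\<lambda>g. internal_param \<Sigma> W (g \<Lambda>) - c)"
proof -
  have "continuous_map (pointwise_topology \<Sigma> W) euclidean (internal_param \<Sigma> W \<circ> (\<lambda>g. g \<Lambda>))"
    by (rule continuous_map_compose[OF continuous_map_product_projection[OF assms]
          continuous_map_internal_param])
  moreover have "continuous_map euclidean euclidean (\<lambda>h::'h. h - c)"
    by (auto intro!: continuous_intros)
  ultimately have "continuous_map (pointwise_topology \<Sigma> W) euclidean
      ((\<lambda>h. h - c) \<circ> (internal_param \<Sigma> W \<circ> (\<lambda>g. g \<Lambda>)))"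
    by (rule continuous_map_compose)
  then show ?thesis by (simp add: o_def)
qed

text \<open>Both sides are continuous in \<open>g\<close> and equal
  \<open>star \<Sigma> \<gamma>\<close> at \<open>Gam_act \<Sigma> W \<gamma>\<close>; as
  \<open>H\<close> is Hausdorff, they agree on the closure.\<close>

lemma internal_param_shift:
  assumes g: "g \<in> ellis \<Sigma> W" and \<Lambda>: "\<Lambda> \<in> internal \<Sigma> W" and M: "M \<in> internal \<Sigma> W"
  shows "internal_param \<Sigma> W (g \<Lambda>) - internal_param \<Sigma> W \<Lambda> =
    internal_param \<Sigma> W (g M) - internal_param \<Sigma> W M"
proof (rule forall_in_closure_of_eq[OF _ Hausdorff_space_euclidean_t2, where x = g
      and f = "\<lambda>g. internal_param \<Sigma> W (g \<Lambda>) - internal_param \<Sigma> W \<Lambda>"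
      and g = "\<lambda>g. internal_param \<Sigma> W (g M) - internal_param \<Sigma> W M"])
  show "g \<in> pointwise_topology \<Sigma> W closure_of (Gam_act \<Sigma> W ` \<Gamma>)"
    using g by (simp add: ellis_def)
  show "continuous_map (pointwise_topology \<Sigma> W) euclidean
      (\<lambda>g. internal_param \<Sigma> W (g \<Lambda>) - internal_param \<Sigma> W \<Lambda>)"
    "continuous_map (pointwise_topology \<Sigma> W) euclidean
      (\<lambda>g. internal_param \<Sigma> W (g M) - internal_param \<Sigma> W M)"
    by (rule continuous_map_internal_param_apply[OF \<Lambda>],
        rule continuous_map_internal_param_apply[OF M])
  fix g assume "g \<in> Gam_act \<Sigma> W ` \<Gamma>"
  then obtain \<gamma> where \<gamma>: "\<gamma> \<in> \<Gamma>" "g = Gam_act \<Sigma> W \<gamma>" by (rule imageE)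
  then show "internal_param \<Sigma> W (g \<Lambda>) - internal_param \<Sigma> W \<Lambda> =
      internal_param \<Sigma> W (g M) - internal_param \<Sigma> W M"
    by (simp add: internal_param_Gam_act[OF \<gamma>(1) \<Lambda>] internal_param_Gam_act[OF \<gamma>(1) M])
qed

section \<open>The morphism to the internal group\<close>

text \<open>On the Ellis semigroup the choice of \<open>\<Lambda>\<close> is immaterial, by
  \<open>internal_param_shift\<close>.\<close>

definition ellis_shift :: "((real ^ 'd) set \<Rightarrow> (real ^ 'd) set) \<Rightarrow> 'h" where
  "ellis_shift g = (let \<Lambda> = SOME \<Lambda>. \<Lambda> \<in> internal \<Sigma> W
     in internal_param \<Sigma> W (g \<Lambda>) - internal_param \<Sigma> W \<Lambda>)"

lemma ellis_shift_eq:
  assumes "g \<in> ellis \<Sigma> W" "\<Lambda> \<in> internal \<Sigma> W"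
  shows "ellis_shift g = internal_param \<Sigma> W (g \<Lambda>) - internal_param \<Sigma> W \<Lambda>"
  unfolding ellis_shift_def Let_def
  by (rule internal_param_shift[OF assms(1) _ assms(2)]) (simp add: some_in_eq internal_nonempty)

lemma internal_param_ellis:
  "g \<in> ellis \<Sigma> W \<Longrightarrow> \<Lambda> \<in> internal \<Sigma> W \<Longrightarrow>
    internal_param \<Sigma> W (g \<Lambda>) = internal_param \<Sigma> W \<Lambda> + ellis_shift g"
  using ellis_shift_eq[of g \<Lambda>] by simp

lemma ellis_shift_mult:
  assumes "g \<in> ellis \<Sigma> W" "h \<in> ellis \<Sigma> W"
  shows "ellis_shift (ellis_mult \<Sigma> W g h) = ellis_shift g + ellis_shift h"
proof -
  obtain \<Lambda> where \<Lambda>: "\<Lambda> \<in> internal \<Sigma> W" using internal_nonempty by blast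
  have "ellis_shift (ellis_mult \<Sigma> W g h) =
      internal_param \<Sigma> W (h (g \<Lambda>)) - internal_param \<Sigma> W \<Lambda>"
    using \<Lambda> by (subst ellis_shift_eq[OF ellis_mult_closed[OF cps assms] \<Lambda>])
      (simp add: ellis_mult_def compose_def)
  then show ?thesis using assms \<Lambda> by (simp add: internal_param_ellis ellis_apply)
qed

lemma continuous_map_ellis_shift: "continuous_map (ellis_topology \<Sigma> W) euclidean ellis_shift"
proof -
  obtain \<Lambda> where \<Lambda>: "\<Lambda> \<in> internal \<Sigma> W" using internal_nonempty by blast
  have "continuous_map (ellis_topology \<Sigma> W) euclidean
      (\<lambda>g. internal_param \<Sigma> W (g \<Lambda>) - internal_param \<Sigma> W \<Lambda>)"
    unfolding ellis_topology_def
    by (intro continuous_map_from_subtopology continuous_map_internal_param_apply \<Lambda>)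
  then show ?thesis
    by (rule continuous_map_eq) (simp add: ellis_shift_eq[OF _ \<Lambda>])
qed

text \<open>By equivariance, \<open>ellis_shift g \<in> C\<close> amounts to one coordinate
  condition for every \<open>\<Lambda>\<close>: the parameter of \<open>g \<Lambda>\<close> lies in
  a translate of \<open>C\<close>. These conditions cut out a product of compact sets. A single
  \<open>\<Lambda>\<close> suffices for the converse direction.\<close>

lemma compactin_ellis_shift_vimage:
  assumes C: "compact C"
  shows "compactin (ellis_topology \<Sigma> W) {g \<in> ellis \<Sigma> W. ellis_shift g \<in> C}"
proof -
  let ?S = "\<lambda>\<Lambda>. {M \<in> internal \<Sigma> W. internal_param \<Sigma> W M \<in> (+) (internal_param \<Sigma> W \<Lambda>) ` C}"
  have "compact ((+) w ` C)" for w
    by (intro compact_continuous_image continuous_intros C)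
  then have "compactin (internal_topology \<Sigma> W) (?S \<Lambda>)" for \<Lambda>
    by (rule compactin_internal_param_vimage)
  then have "compactin (pointwise_topology \<Sigma> W) (PiE (internal \<Sigma> W) ?S)"
    by (simp add: compactin_PiE)
  moreover have "closedin (pointwise_topology \<Sigma> W) (ellis \<Sigma> W)"
    unfolding ellis_def by (rule closedin_closure_of)
  ultimately have "compactin (pointwise_topology \<Sigma> W) (ellis \<Sigma> W \<inter> PiE (internal \<Sigma> W) ?S)"
    by (intro closed_Int_compactin)
  also have "ellis \<Sigma> W \<inter> PiE (internal \<Sigma> W) ?S = {g \<in> ellis \<Sigma> W. ellis_shift g \<in> C}"
  proof (intro equalityI subsetI)
    fix g assume g: "g \<in> ellis \<Sigma> W \<inter> PiE (internal \<Sigma> W) ?S"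
    obtain \<Lambda> where \<Lambda>: "\<Lambda> \<in> internal \<Sigma> W" using internal_nonempty by blast
    with g have "g \<Lambda> \<in> ?S \<Lambda>" by blast
    with g \<Lambda> show "g \<in> {g \<in> ellis \<Sigma> W. ellis_shift g \<in> C}"
      by (auto simp: internal_param_ellis)
  next
    fix g assume "g \<in> {g \<in> ellis \<Sigma> W. ellis_shift g \<in> C}"
    then show "g \<in> ellis \<Sigma> W \<inter> PiE (internal \<Sigma> W) ?S"
      using ellis_subset by (auto simp: internal_param_ellis PiE_iff subset_iff)
  qed
  finally show ?thesis
    by (auto simp: ellis_topology_def compactin_subtopology)
qed

text \<open>Compact preimages suffice because the target is locally compact Hausdorff, hence a
  k-space whose compact sets are closed.\<close>

lemma proper_map_ellis_shift: "proper_map (ellis_topology \<Sigma> W) euclidean ellis_shift"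
  using compactin_ellis_shift_vimage
  by (intro compact_imp_proper_map locally_compact_imp_k_space Hausdorff_imp_kc_space
      Hausdorff_space_euclidean_t2 disjI1 continuous_map_ellis_shift locally_compact_H) simp_all

lemma ellis_shift_surj: "ellis_shift ` ellis \<Sigma> W = UNIV"
proof -
  have "closed (ellis_shift ` ellis \<Sigma> W)"
    using proper_imp_closed_map[OF proper_map_ellis_shift] closedin_topspace[of "ellis_topology \<Sigma> W"]
    by (auto simp: closed_map_def simp del: closedin_topspace)
  moreover have "star \<Sigma> ` \<Gamma> \<subseteq> ellis_shift ` ellis \<Sigma> W"
  proof
    fix s assume "s \<in> star \<Sigma> ` \<Gamma>"
    then obtain \<gamma> where \<gamma>: "\<gamma> \<in> \<Gamma>" "s = star \<Sigma> \<gamma>" by blast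
    obtain \<Lambda> where "\<Lambda> \<in> internal \<Sigma> W" using internal_nonempty by blast
    with \<gamma> have "s = ellis_shift (Gam_act \<Sigma> W \<gamma>)"
      using internal_param_ellis[OF Gam_act_in_ellis] internal_param_Gam_act by (metis add_left_cancel)
    then show "s \<in> ellis_shift ` ellis \<Sigma> W" using Gam_act_in_ellis[OF \<gamma>(1)] by blast
  qed
  ultimately have "closure (star \<Sigma> ` \<Gamma>) \<subseteq> ellis_shift ` ellis \<Sigma> W"
    by (intro closure_minimal)
  then show ?thesis using cps by (auto simp: star_image cut_and_project_scheme_def)
qed

end

theorem proposition3p5:
  fixes \<Sigma> :: "('h::{topological_ab_group_add, t2_space} \<times> (real ^ 'd)) set"
    and W :: "'h set"
  assumes "cut_and_project_scheme \<Sigma>"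
    and "window W"
  shows "\<exists>\<phi>. continuous_map (ellis_topology \<Sigma> W) euclidean \<phi> \<and>
             proper_map (ellis_topology \<Sigma> W) euclidean \<phi> \<and>
             \<phi> ` ellis \<Sigma> W = UNIV \<and>
             (\<forall>g \<in> ellis \<Sigma> W. \<forall>h \<in> ellis \<Sigma> W. \<phi> (ellis_mult \<Sigma> W g h) = \<phi> g + \<phi> h) \<and>
             (\<forall>\<Lambda> \<in> internal \<Sigma> W. \<forall>g \<in> ellis \<Sigma> W.
                internal_param \<Sigma> W (g \<Lambda>) = internal_param \<Sigma> W \<Lambda> + \<phi> g)"
proof (cases "W = {}")
  case False
  with assms interpret cps_window \<Sigma> W by unfold_locales
  show ?thesis
    using continuous_map_ellis_shift proper_map_ellis_shift ellis_shift_surj ellis_shift_mult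
      internal_param_ellis
    by (intro exI[of _ ellis_shift]) simp
next
  case True
  text \<open>Irredundancy of the empty window forces \<open>H\<close> to be trivial.\<close>
  then have H: "h = 0" for h :: 'h using assms(2) by (simp add: window_def)
  \<comment> \<open>The frontier of the empty window is empty, so every parameter is nonsingular and
    every model set is empty, with empty language.\<close>
  have "language_NS \<Sigma> W = {}"
    by (auto simp: language_NS_def True NS_def proj_set_def)
  then have "internal \<Sigma> W = {{}}"
    by (auto simp: internal_def cps_hull_def)
  then have top: "topspace (pointwise_topology \<Sigma> W) = ({{}} \<rightarrow>\<^sub>E {{}})" by simp
  have "ellis \<Sigma> W \<subseteq> ({{}} \<rightarrow>\<^sub>E {{}})"
    unfolding ellis_def top[symmetric] by (rule closure_of_subset_topspace)
  then have "finite (ellis \<Sigma> W)"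
    by (rule finite_subset) (simp add: finite_PiE)
  have closed: "closed A" for A :: "'h set"
    using H by (intro finite_imp_closed finite_subset[of A "{0}"]) auto
  have "Gam_act \<Sigma> W ` Gam \<Sigma> \<subseteq> topspace (pointwise_topology \<Sigma> W)"
    using translate_internal[OF assms(1)] by (auto simp: Gam_act_def)
  then have "Gam_act \<Sigma> W ` Gam \<Sigma> \<subseteq> ellis \<Sigma> W"
    unfolding ellis_def by (rule closure_of_subset)
  then have "ellis \<Sigma> W \<noteq> {}"
    using add_subgroup_Gam[OF assms(1)] by (auto simp: add_subgroup_def)
  then have "(\<lambda>g. 0 :: 'h) ` ellis \<Sigma> W = UNIV" using H by auto
  \<comment> \<open>The zero map is the morphism here: all subsets of \<open>H\<close> are closed,
    and fibres are compact since \<open>ellis \<Sigma> W\<close> is finite.\<close>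
  moreover have "proper_map (ellis_topology \<Sigma> W) euclidean (\<lambda>g. 0 :: 'h)"
    using closed \<open>finite (ellis \<Sigma> W)\<close>
    by (auto simp: proper_map_def closed_map_def intro!: finite_imp_compactin)
  ultimately show ?thesis
    using H by (intro exI[of _ "\<lambda>_. 0"]) (simp; metis H)
qed

end
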